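(* Let $M\ge 1$. For all sizes $k_1,\dots,k_M$, $L_p^{\mathrm I},L_p^{\mathrm{II}}$ ($1\le p\le M-1$), $L_M$, all variables $\bm x^{(p)},\bm y_{\mathrm I}^{(p)},\bm y_{\mathrm{II}}^{(p)},\bm y^{(M)}$ and every admissible colouring $\bm I$, the rational $\mathfrak{gl}_{M+1}$ partition function $\psi$ equals the extended rational weight function $W$: $$\psi\big(\bm x^{(1)},\dots,\bm x^{(M)}\,\big|\,\{\bm y_{\mathrm I}^{(1)},\bm y_{\mathrm{II}}^{(1)}\},\dots,\{\bm y_{\mathrm I}^{(M-1)},\bm y_{\mathrm{II}}^{(M-1)}\},\bm y^{(M)}\,\big|\,\bm I\big)=W\big(\bm x^{(1)},\dots,\bm x^{(M)}\,\big|\,\{\bm y_{\mathrm I}^{(1)},\bm y_{\mathrm{II}}^{(1)}\},\dots,\{\bm y_{\mathrm I}^{(M-1)},\bm y_{\mathrm{II}}^{(M-1)}\},\bm y^{(M)}\,\big|\,\bm I\big)$$ (an identity of rational functions in the variables).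
   Context: **Sizes, variables, coordinates.** Fix $M\ge1$ and nonnegative integers $k_1,\dots,k_M$, $L_p^{\mathrm I},L_p^{\mathrm{II}}$ ($1\le p\le M-1$), $L_M$. There are ordered lists of variables $\bm x^{(p)}=(x^{(p)}_1,\dots,x^{(p)}_{k_p})$ ($1\le p\le M$), $\bm y^{(p)}_{\mathrm I}=(y^{(p)}_{\mathrm I,1},\dots,y^{(p)}_{\mathrm I,L^{\mathrm I}_p})$, $\bm y^{(p)}_{\mathrm{II}}=(y^{(p)}_{\mathrm{II},1},\dots,y^{(p)}_{\mathrm{II},L^{\mathrm{II}}_p})$ ($1\le p\le M-1$), $\bm y^{(M)}=(y^{(M)}_1,\dots,y^{(M)}_{L_M})$. The sizes are the lengths of the lists and are omitted from the notation of functions. Order the $y$-variables as $\bm y_{\mathrm I}^{(1)},\dots,\bm y_{\mathrm I}^{(M-1)},\bm y^{(M)},\bm y_{\mathrm{II}}^{(M-1)},\dots,\bm y_{\mathrm{II}}^{(1)}$; the $c$-th variable in this list defines the coordinate $c\in\{1,2,\dots\}$. A coordinate is in layer $p<M$ if its variable belongs to $\bm y_{\mathrm I}^{(p)}$ or $\bm y_{\mathrm{II}}^{(p)}$, and in layer $M$ if it belongs to $\bm y^{(M)}$. **Colourings.** A colouring assigns to each coordinate $c$ of layer $p$ a colour $i_c^{(p)}\in\{1,\dots,p+1\}$. For $1\le j\le M$, let $\widehat{\bm I}^{(j)}$ be the set of coordinates in layers $j,\dots,M$ and $\bm I^{(j)}=\bm I^{(j)}_{k_j}\subset\widehat{\bm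 I}^{(j)}$ the subset of those with colour in $\{1,\dots,j\}$. The colouring is admissible if $|\bm I^{(j)}|=k_j$ for all $j$; write $\bm I^{(j)}=\{I^{(j)}_1<\dots<I^{(j)}_{k_j}\}$ and $\bm I=(\bm I^{(1)},\dots,\bm I^{(M)})$ (this determines the colouring). For $1\le j\le M-1$, the elements of $\widehat{\bm I}^{(j)}$ with colour in $\{1,\dots,j+1\}$ number $k_{j+1}+L_j^{\mathrm I}+L_j^{\mathrm{II}}$; relabel them in increasing order by $1,2,\dots,k_{j+1}+L_j^{\mathrm I}+L_j^{\mathrm{II}}$, and let $\widetilde{\bm I}^{(j)}=\{\widetilde I^{(j)}_1<\dots<\widetilde I^{(j)}_{k_j}\}$ be the image of $\bm I^{(j)}$. **Column variables.** For $p<M$ and ordered lists $\bm y_{\mathrm I}^{(p)},\bm x^{(p+1)},\bm y_{\mathrm{II}}^{(p)}$, let $m_i(\bm y^{(p)}_{\mathrm I}|\bm x^{(p+1)}|\bm y^{(p)}_{\mathrm{II}})$ be the $i$-th entry of the concatenated list $(\bm y^{(p)}_{\mathrm I},\bm x^{(p+1)},\bm y^{(p)}_{\mathrm{II}})$. **Partition function.** Put $N_p=L_p^{\mathrm I}+k_{p+1}+L_p^{\mathrm{II}}$ for $p<M$, $N_M=L_M$. Layer $p$ is a grid with rows $r=1,\dots,k_p$ (top to bottom; row $r$ carries $x^{(p)}_r$) and columns $s=1,\dots,N_p$ (left to right; column $s$ carries $m_s(\bm y^{(p)}_{\mathrm I}|\bm x^{(p+1)}|\bm y^{(p)}_{\mathrm{II}})$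 if $p<M$, and $y^{(M)}_s$ if $p=M$). Edges carry colours in $\{1,\dots,M+1\}$: horizontal $h^{(p)}_{r,s}$ ($0\le s\le N_p$) and vertical $v^{(p)}_{r,s}$ ($0\le r\le k_p$); vertex $(r,s)$ has left, right, bottom, top edges $h^{(p)}_{r,s-1},h^{(p)}_{r,s},v^{(p)}_{r,s},v^{(p)}_{r-1,s}$. Boundary conditions: $h^{(p)}_{r,N_p}=p+1$ for all $r$; $v^{(p)}_{k_p,s}=p+1$ for all $s$ as bottom boundary colours; $h^{(1)}_{r,0}=1$; $h^{(p+1)}_{r,0}=v^{(p)}_{0,L_p^{\mathrm I}+r}$ for $1\le r\le k_{p+1}$, $p<M$; and the top edge $v^{(p)}_{0,s}$ of a column carrying a $y$-variable has the colour of the corresponding coordinate. A vertex with left, bottom, right, top colours $(a,b,c,d)$, row variable $x$ and column variable $y$ has weight: $x-y+1$ if $a=b=c=d$; $x-y$ if $c=a\ne b=d$; $1$ if $c=b\neq a=d$; $0$ otherwise. (This is the coefficient of $e_c\otimes e_d$ in $R(x,y)(e_a\otimes e_b)$, where $R(x,y)=\sum_i(x-y+1)E_{ii}\otimes E_{ii}+\sum_{i\ne j}(x-y)E_{ii}\otimes E_{jj}+\sum_{i\neq j}E_{ij}\otimes E_{ji}$.) Then $\psi$ is the sum over all edge colourings satisfying the boundary conditions of the product of the weights of all vertices in all layers. **Extended rational weight function.** With $\bm x^{(p)}_{\sigma_p}=(x^{(p)}_{\sigma_p(1)},\dots,x^{(p)}_{\sigma_p(k_p)})$, $m_i^{(p)}:=m_i(\bm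 y^{(p)}_{\mathrm I}|\bm x^{(p+1)}_{\sigma_{p+1}}|\bm y^{(p)}_{\mathrm{II}})$ and $\ell:=L^{\mathrm I}_1+\dots+L^{\mathrm I}_{M-1}$, $$W=\sum_{\sigma_1\in S_{k_1}}\cdots\sum_{\sigma_M\in S_{k_M}}\prod_{p=1}^{M-1}\Bigg\{\prod_{a=1}^{k_p}\Bigg(\prod_{i=1}^{\widetilde I^{(p)}_a-1}\big(x^{(p)}_{\sigma_p(a)}-m^{(p)}_i\big)\prod_{i=\widetilde I^{(p)}_a+1}^{N_p}\big(x^{(p)}_{\sigma_p(a)}-m^{(p)}_i+1\big)\Bigg)\prod_{1\le a<b\le k_p}\frac{x^{(p)}_{\sigma_p(a)}-x^{(p)}_{\sigma_p(b)}-1}{x^{(p)}_{\sigma_p(a)}-x^{(p)}_{\sigma_p(b)}}\Bigg\}$$ $$\times\prod_{a=1}^{k_M}\Bigg(\prod_{i=1}^{I^{(M)}_a-1-\ell}\big(x^{(M)}_{\sigma_M(a)}-y^{(M)}_i\big)\prod_{i=I^{(M)}_a+1-\ell}^{L_M}\big(x^{(M)}_{\sigma_M(a)}-y^{(M)}_i+1\big)\Bigg)\prod_{1\le a<b\le k_M}\frac{x^{(M)}_{\sigma_M(a)}-x^{(M)}_{\sigma_M(b)}-1}{x^{(M)}_{\sigma_M(a)}-x^{(M)}_{\sigma_M(b)}}.$$ *)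

theory Defs
  imports Complex_Main "HOL-Library.FuncSet" "HOL-Combinatorics.Permutations"
begin

text \<open>
  All indices are 1-based. An ordered list of variables is a function on \<open>nat\<close> together with its
  length: \<open>x p\<close> on \<open>{1..k p}\<close>, \<open>yI p\<close> on \<open>{1..LI p}\<close>, \<open>yII p\<close> on \<open>{1..LII p}\<close>, \<open>yM\<close> on
  \<open>{1..LM}\<close>. Values outside these ranges play no role.
\<close>

definition nth_smallest :: "nat set \<Rightarrow> nat \<Rightarrow> nat" where
  "nth_smallest A a = sorted_list_of_set A ! (a - 1)"

text \<open>Arguments \<open>a b c d\<close>: colours of the left, bottom, right and top edge of the vertex.\<close>

definition vertex_weight :: "'a::field \<Rightarrow> 'a \<Rightarrow> nat \<Rightarrow> nat \<Rightarrow> nat \<Rightarrow> nat \<Rightarrow> 'a" where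
  "vertex_weight x y a b c d =
     (if a = b \<and> b = c \<and> c = d then x - y + 1
      else if c = a \<and> b = d \<and> a \<noteq> b then x - y
      else if c = b \<and> a = d \<and> a \<noteq> b then 1
      else 0)"

locale layers =
  fixes M :: nat and k LI LII :: "nat \<Rightarrow> nat" and LM :: nat
begin

definition N :: "nat \<Rightarrow> nat" where
  "N p = (if p < M then LI p + k (p + 1) + LII p else LM)"

definition ell :: nat where
  "ell = (\<Sum>q\<in>{1..<M}. LI q)"


text \<open>
  Coordinates of the variables \<open>yI p s\<close>, \<open>yM s\<close>, \<open>yII p s\<close>, for the order
  \<open>yI 1, \<dots>, yI (M-1), yM, yII (M-1), \<dots>, yII 1\<close>.
\<close>

definition coordI :: "nat \<Rightarrow> nat \<Rightarrow> nat" where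
  "coordI p s = (\<Sum>q\<in>{1..<p}. LI q) + s"

definition coordM :: "nat \<Rightarrow> nat" where
  "coordM s = ell + s"

definition coordII :: "nat \<Rightarrow> nat \<Rightarrow> nat" where
  "coordII p s = ell + LM + (\<Sum>q\<in>{p<..<M}. LII q) + s"

definition layer_coords :: "nat \<Rightarrow> nat set" where
  "layer_coords p =
     (if p < M then coordI p ` {1..LI p} \<union> coordII p ` {1..LII p} else coordM ` {1..LM})"


definition I_hat :: "nat \<Rightarrow> nat set" where
  "I_hat j = (\<Union>p\<in>{j..M}. layer_coords p)"

definition I_set :: "(nat \<Rightarrow> nat) \<Rightarrow> nat \<Rightarrow> nat set" where
  "I_set col j = {c \<in> I_hat j. col c \<in> {1..j}}"

definition admissible :: "(nat \<Rightarrow> nat) \<Rightarrow> bool" where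
  "admissible col \<longleftrightarrow>
     (\<forall>p\<in>{1..M}. \<forall>c\<in>layer_coords p. col c \<in> {1..p + 1}) \<and>
     (\<forall>j\<in>{1..M}. card (I_set col j) = k j)"

definition relabel :: "(nat \<Rightarrow> nat) \<Rightarrow> nat \<Rightarrow> nat \<Rightarrow> nat" where
  "relabel col j c = card {d \<in> I_hat j. col d \<in> {1..j + 1} \<and> d \<le> c}"

definition I_tilde :: "(nat \<Rightarrow> nat) \<Rightarrow> nat \<Rightarrow> nat set" where
  "I_tilde col j = relabel col j ` I_set col j"


text \<open>The \<open>i\<close>-th entry of the concatenation of \<open>yI p\<close>, \<open>x'\<close> and \<open>yII p\<close>, where \<open>x'\<close> has
  length \<open>k (p + 1)\<close>.\<close>

definition m :: "(nat \<Rightarrow> nat \<Rightarrow> 'a) \<Rightarrow> (nat \<Rightarrow> nat \<Rightarrow> 'a) \<Rightarrow> nat \<Rightarrow> (nat \<Rightarrow> 'a) \<Rightarrow> nat \<Rightarrow> 'a" where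
  "m yI yII p x' i =
     (if i \<le> LI p then yI p i
      else if i \<le> LI p + k (p + 1) then x' (i - LI p)
      else yII p (i - LI p - k (p + 1)))"

definition column_var ::
  "(nat \<Rightarrow> nat \<Rightarrow> 'a) \<Rightarrow> (nat \<Rightarrow> nat \<Rightarrow> 'a) \<Rightarrow> (nat \<Rightarrow> nat \<Rightarrow> 'a) \<Rightarrow> (nat \<Rightarrow> 'a) \<Rightarrow> nat \<Rightarrow> nat \<Rightarrow> 'a" where
  "column_var x yI yII yM p s = (if p < M then m yI yII p (x (p + 1)) s else yM s)"


text \<open>Edges are indexed by triples \<open>(p, r, s)\<close>: layer, row, column. Edge colourings are
  extensional functions, so that there are finitely many of them.\<close>

definition h_edges :: "(nat \<times> nat \<times> nat) set" where
  "h_edges = {(p, r, s). p \<in> {1..M} \<and> r \<in> {1..k p} \<and> s \<in> {0..N p}}"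

definition v_edges :: "(nat \<times> nat \<times> nat) set" where
  "v_edges = {(p, r, s). p \<in> {1..M} \<and> r \<in> {0..k p} \<and> s \<in> {1..N p}}"

definition boundary ::
  "(nat \<Rightarrow> nat) \<Rightarrow> (nat \<times> nat \<times> nat \<Rightarrow> nat) \<Rightarrow> (nat \<times> nat \<times> nat \<Rightarrow> nat) \<Rightarrow> bool" where
  "boundary col h v \<longleftrightarrow>
     (\<forall>p\<in>{1..M}. \<forall>r\<in>{1..k p}. h (p, r, N p) = p + 1) \<and>
     (\<forall>p\<in>{1..M}. \<forall>s\<in>{1..N p}. v (p, k p, s) = p + 1) \<and>
     (\<forall>r\<in>{1..k 1}. h (1, r, 0) = 1) \<and>
     (\<forall>p\<in>{1..<M}. \<forall>r\<in>{1..k (p + 1)}. h (p + 1, r, 0) = v (p, 0, LI p + r)) \<and>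
     (\<forall>p\<in>{1..<M}. \<forall>s\<in>{1..LI p}. v (p, 0, s) = col (coordI p s)) \<and>
     (\<forall>p\<in>{1..<M}. \<forall>s\<in>{1..LII p}. v (p, 0, LI p + k (p + 1) + s) = col (coordII p s)) \<and>
     (\<forall>s\<in>{1..LM}. v (M, 0, s) = col (coordM s))"

definition edge_colourings ::
  "(nat \<Rightarrow> nat) \<Rightarrow> ((nat \<times> nat \<times> nat \<Rightarrow> nat) \<times> (nat \<times> nat \<times> nat \<Rightarrow> nat)) set" where
  "edge_colourings col =
     {(h, v). h \<in> (\<Pi>\<^sub>E e\<in>h_edges. {1..M + 1}) \<and> v \<in> (\<Pi>\<^sub>E e\<in>v_edges. {1..M + 1}) \<and>
              boundary col h v}"

definition psi ::
  "(nat \<Rightarrow> nat \<Rightarrow> 'a::field) \<Rightarrow> (nat \<Rightarrow> nat \<Rightarrow> 'a) \<Rightarrow> (nat \<Rightarrow> nat \<Rightarrow> 'a) \<Rightarrow> (nat \<Rightarrow> 'a) \<Rightarrow>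
   (nat \<Rightarrow> nat) \<Rightarrow> 'a" where
  "psi x yI yII yM col =
     (\<Sum>(h, v)\<in>edge_colourings col.
        \<Prod>p=1..M. \<Prod>r=1..k p. \<Prod>s=1..N p.
          vertex_weight (x p r) (column_var x yI yII yM p s)
            (h (p, r, s - 1)) (v (p, r, s)) (h (p, r, s)) (v (p, r - 1, s)))"


definition pair_factor :: "nat \<Rightarrow> (nat \<Rightarrow> 'a::field) \<Rightarrow> 'a" where
  "pair_factor n z = (\<Prod>(a, b)\<in>{(a, b). 1 \<le> a \<and> a < b \<and> b \<le> n}. (z a - z b - 1) / (z a - z b))"

text \<open>The tuple \<open>(\<sigma>\<^sub>1, \<dots>, \<sigma>\<^sub>M)\<close> of permutations is an extensional function \<open>\<sigma>\<close> on \<open>{1..M}\<close>;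
  \<open>xs p\<close> is the permuted list of the variables \<open>x p\<close>.\<close>

definition W ::
  "(nat \<Rightarrow> nat \<Rightarrow> 'a::field) \<Rightarrow> (nat \<Rightarrow> nat \<Rightarrow> 'a) \<Rightarrow> (nat \<Rightarrow> nat \<Rightarrow> 'a) \<Rightarrow> (nat \<Rightarrow> 'a) \<Rightarrow>
   (nat \<Rightarrow> nat) \<Rightarrow> 'a" where
  "W x yI yII yM col =
     (\<Sum>\<sigma>\<in>(\<Pi>\<^sub>E p\<in>{1..M}. {\<pi>. \<pi> permutes {1..k p}}).
        let xs = (\<lambda>p a. x p (\<sigma> p a));
            It = (\<lambda>p a. nth_smallest (I_tilde col p) a);
            IM = (\<lambda>a. nth_smallest (I_set col M) a)
        in
          (\<Prod>p\<in>{1..<M}.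
             (\<Prod>a=1..k p.
                (\<Prod>i=1..It p a - 1. xs p a - m yI yII p (xs (p + 1)) i) *
                (\<Prod>i=It p a + 1..N p. xs p a - m yI yII p (xs (p + 1)) i + 1)) *
             pair_factor (k p) (xs p)) *
          (\<Prod>a=1..k M.
             (\<Prod>i=1..IM a - 1 - ell. xs M a - yM i) *
             (\<Prod>i=IM a + 1 - ell..LM. xs M a - yM i + 1)) *
          pair_factor (k M) (xs M))"

end

end

theory Submission
  imports Defs
begin

text \<open>
  The vertex weight is \<open>(x - y) [a = c, b = d] + [a = d, b = c]\<close>, so summing over the two incoming
  colours of a vertex turns a function \<open>g\<close> of them into \<open>(x - y) g(c, d) + g(d, c)\<close>. The partition
  function is therefore a composition of such vertex operators, applied column by column and layer
  by layer to functions of the row colours. Two instances of the Yang--Baxter equation follow from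
  this form: exchanging two adjacent columns of layer \<open>p - 1\<close> (with their variables and top colours)
  gives \<open>(z\<^sub>a - z\<^sub>b + 1) F(s z, w) = (z\<^sub>a - z\<^sub>b) F(z, s w) + F(z, w)\<close> for \<open>b = a + 1\<close> and \<open>s\<close> the
  transposition of \<open>a\<close> and \<open>b\<close>, and every column operator of layer \<open>p\<close> preserves this relation.

  Call \<open>p + 1\<close> the vacuum colour of layer \<open>p\<close>. By induction on the number of columns, the state whose
  first \<open>t\<close> rows carry the vacuum is a sum over \<open>S\<^sub>t\<close>: a column with vacuum top only multiplies the
  state by a scalar; in a column with another top colour one row \<open>r \<le> t\<close> emits that colour, and the
  exchange relation moves \<open>r\<close> to position \<open>t\<close>, which creates the factors
  \<open>(z\<^sub>a - z\<^sub>b - 1) / (z\<^sub>a - z\<^sub>b)\<close>. Iterating over the layers gives the weight function.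
\<close>

section \<open>Vertex operators and exchange relations\<close>

text \<open>
  In \<open>g w d\<close>, \<open>w\<close> lists the colours of the horizontal edges at the current position in each row and
  \<open>d\<close> is the colour of the vertical edge.
\<close>

definition vtx :: "'a::field \<Rightarrow> nat \<Rightarrow> ((nat \<Rightarrow> nat) \<Rightarrow> nat \<Rightarrow> 'a) \<Rightarrow> (nat \<Rightarrow> nat) \<Rightarrow> nat \<Rightarrow> 'a" where
  "vtx t r g w d = t * g w d + g (w(r := d)) (w r)"

text \<open>Row 1, the top row, is the outermost operator, so the final colour argument is that of
  the top edge; the innermost function imposes the bottom boundary colour.\<close>

definition column_op ::
  "(nat \<Rightarrow> 'a::field) \<Rightarrow> nat \<Rightarrow> nat \<Rightarrow> 'a \<Rightarrow> ((nat \<Rightarrow> nat) \<Rightarrow> 'a) \<Rightarrow> (nat \<Rightarrow> nat) \<Rightarrow> nat \<Rightarrow> 'a" where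
  "column_op z k vac y f =
     foldr (\<lambda>r. vtx (z r - y) r) [1..<Suc k] (\<lambda>w b. f w * of_bool (b = vac))"

text \<open>Columns are stripped from the right: column \<open>Suc n\<close> is outermost,
  \<open>w\<close> lists the right boundary colours, and \<open>f\<close> finally receives the
  colours of the left edges.\<close>

primrec layer_op ::
  "(nat \<Rightarrow> 'a::field) \<Rightarrow> nat \<Rightarrow> nat \<Rightarrow> (nat \<Rightarrow> 'a) \<Rightarrow> (nat \<Rightarrow> nat) \<Rightarrow> nat \<Rightarrow> ((nat \<Rightarrow> nat) \<Rightarrow> 'a) \<Rightarrow>
   (nat \<Rightarrow> nat) \<Rightarrow> 'a" where
  "layer_op z k vac y u 0 f = f"
| "layer_op z k vac y u (Suc n) f =
     (\<lambda>w. column_op z k vac (y (Suc n)) (layer_op z k vac y u n f) w (u (Suc n)))"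

text \<open>The action of the R-matrix on two neighbouring rows, with \<open>f'\<close> belonging to
  the interchanged variables. It is cleared of denominators because \<open>t + 1\<close> may
  vanish.\<close>

definition exch :: "'a::field \<Rightarrow> nat \<Rightarrow> ((nat \<Rightarrow> nat) \<Rightarrow> 'a) \<Rightarrow> ((nat \<Rightarrow> nat) \<Rightarrow> 'a) \<Rightarrow> bool" where
  "exch t a f f' \<longleftrightarrow> (\<forall>w. (t + 1) * f' w = t * f (w \<circ> transpose a (Suc a)) + f w)"

section \<open>Exchange of two adjacent rows\<close>

lemma comp_transpose_upd:
  "r \<noteq> a \<Longrightarrow> r \<noteq> Suc a \<Longrightarrow> w(r := d) \<circ> transpose a (Suc a) = (w \<circ> transpose a (Suc a))(r := d)"
  by (auto simp: fun_eq_iff transpose_def)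

lemma comp_transpose_upds:
  "w \<circ> transpose a (Suc a) = w(a := w (Suc a), Suc a := w a)"
  by (auto simp: fun_eq_iff transpose_def)

lemma vtx_exch_other:
  assumes "\<And>d. exch t a (\<lambda>w. g w d) (\<lambda>w. g' w d)" "r \<noteq> a" "r \<noteq> Suc a"
  shows "exch t a (\<lambda>w. vtx c r g w d) (\<lambda>w. vtx c r g' w d)"
  unfolding exch_def
proof
  fix w
  have 1: "(t + 1) * g' w d = t * g (w \<circ> transpose a (Suc a)) d + g w d" for w d
    using assms(1) by (auto simp: exch_def)
  have "(t + 1) * vtx c r g' w d = c * ((t + 1) * g' w d) + (t + 1) * g' (w(r := d)) (w r)"
    by (simp add: vtx_def algebra_simps)
  also have "\<dots> = t * vtx c r g (w \<circ> transpose a (Suc a)) d + vtx c r g w d"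
    unfolding 1 comp_transpose_upd[OF assms(2,3)] using assms(2,3)
    by (simp add: vtx_def algebra_simps)
  finally show "(t + 1) * vtx c r g' w d = t * vtx c r g (w \<circ> transpose a (Suc a)) d + vtx c r g w d" .
qed

text \<open>Yang-Baxter equation for two rows crossed by one column. Only the colours of rows
  \<open>a\<close>, \<open>Suc a\<close> and the vertical colour move, so after substituting the
  hypothesis termwise a polynomial identity in \<open>t\<close>, \<open>u2\<close> and the values of
  \<open>G\<close> remains.\<close>

lemma vtx_exch_pair:
  assumes "\<And>d. exch (u1 - u2) a (\<lambda>w. g w d) (\<lambda>w. g' w d)"
  shows "exch (u1 - u2) a (\<lambda>w. vtx u1 a (vtx u2 (Suc a) g) w d) (\<lambda>w. vtx u2 a (vtx u1 (Suc a) g') w d)"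
  unfolding exch_def
proof
  fix w
  define t where "t = u1 - u2"
  have u1: "u1 = t + u2" by (simp add: t_def)
  define G where "G p q = g (w(a := p, Suc a := q))" for p q
  define G' where "G' p q = g' (w(a := p, Suc a := q))" for p q
  have 1: "(t + 1) * G' p q d = t * G q p d + G p q d" for p q d
    using assms(1)[of d, unfolded exch_def, rule_format, of "w(a := p, Suc a := q)"]
    unfolding G_def G'_def t_def comp_transpose_upds by (simp add: fun_upd_twist)
  have w: "g w = G (w a) (w (Suc a))" "g' w = G' (w a) (w (Suc a))"
    by (simp_all add: G_def G'_def)
  have upd: "w(a := d, Suc a := w (Suc a)) = w(a := d)"
    by (simp add: fun_eq_iff)
  have L: "vtx u2 a (vtx u1 (Suc a) g') w d =
     u2 * (u1 * G' (w a) (w (Suc a)) d + G' (w a) d (w (Suc a))) +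
     (u1 * G' d (w (Suc a)) (w a) + G' d (w a) (w (Suc a)))"
    by (simp add: vtx_def G'_def fun_upd_twist upd)
  have R1: "vtx u1 a (vtx u2 (Suc a) g) w d =
     u1 * (u2 * G (w a) (w (Suc a)) d + G (w a) d (w (Suc a))) +
     (u2 * G d (w (Suc a)) (w a) + G d (w a) (w (Suc a)))"
    by (simp add: vtx_def G_def fun_upd_twist upd)
  have R2: "vtx u1 a (vtx u2 (Suc a) g) (w \<circ> transpose a (Suc a)) d =
     u1 * (u2 * G (w (Suc a)) (w a) d + G (w (Suc a)) d (w a)) +
     (u2 * G d (w a) (w (Suc a)) + G d (w (Suc a)) (w a))"
    by (simp add: vtx_def G_def comp_transpose_upds fun_upd_twist)
  have "(t + 1) * vtx u2 a (vtx u1 (Suc a) g') w d =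
     u2 * (u1 * ((t + 1) * G' (w a) (w (Suc a)) d) + (t + 1) * G' (w a) d (w (Suc a))) +
     (u1 * ((t + 1) * G' d (w (Suc a)) (w a)) + (t + 1) * G' d (w a) (w (Suc a)))"
    unfolding L by (simp add: algebra_simps)
  also have "\<dots> = t * vtx u1 a (vtx u2 (Suc a) g) (w \<circ> transpose a (Suc a)) d + vtx u1 a (vtx u2 (Suc a) g) w d"
    unfolding 1 R1 R2 by (simp add: u1 algebra_simps)
  finally show "(u1 - u2 + 1) * vtx u2 a (vtx u1 (Suc a) g') w d =
     (u1 - u2) * vtx u1 a (vtx u2 (Suc a) g) (w \<circ> transpose a (Suc a)) d + vtx u1 a (vtx u2 (Suc a) g) w d"
    by (simp add: t_def)
qed

lemma foldr_vtx_exch: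
  assumes "\<And>d. exch t a (\<lambda>w. g w d) (\<lambda>w. g' w d)" "a \<notin> set rs" "Suc a \<notin> set rs"
    "\<And>r. r \<in> set rs \<Longrightarrow> c' r = c r"
  shows "exch t a (\<lambda>w. foldr (\<lambda>r. vtx (c r) r) rs g w d) (\<lambda>w. foldr (\<lambda>r. vtx (c' r) r) rs g' w d)"
  using assms(2-)
proof (induction rs arbitrary: d)
  case Nil
  then show ?case using assms(1) by simp
next
  case (Cons r rs)
  then show ?case by (auto intro!: vtx_exch_other)
qed

text \<open>The column variable cancels in \<open>(z a - y) - (z (Suc a) - y)\<close>, so
  \<open>vtx_exch_pair\<close> treats the two rows with the right parameter; vertices in the rows
  above and below preserve the relation.\<close>

lemma column_op_exch_row:
  assumes "exch (z a - z (Suc a)) a f f'" "1 \<le> a" "Suc a \<le> k"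
  shows "exch (z a - z (Suc a)) a (\<lambda>w. column_op z k vac y f w d)
     (\<lambda>w. column_op (z \<circ> transpose a (Suc a)) k vac y f' w d)"
proof -
  have l: "[1..<Suc k] = [1..<a] @ [a, Suc a] @ [Suc (Suc a)..<Suc k]"
    using assms(2,3) upt_add_eq_append[of 1 a "Suc k - a"] 
    by (simp add: upt_conv_Cons del: upt_Suc)
  let ?t = "z a - z (Suc a)"
  let ?z = "z \<circ> transpose a (Suc a)"
  let ?g = "\<lambda>w b. f w * of_bool (b = vac)"
  let ?g' = "\<lambda>w b. f' w * of_bool (b = vac)"
  let ?r = "[Suc (Suc a)..<Suc k]"
  have 0: "exch ?t a (\<lambda>w. ?g w d) (\<lambda>w. ?g' w d)" for d
    using assms(1) by (auto simp: exch_def)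
  have 1: "exch ?t a (\<lambda>w. foldr (\<lambda>r. vtx (z r - y) r) ?r ?g w d)
     (\<lambda>w. foldr (\<lambda>r. vtx (?z r - y) r) ?r ?g' w d)" for d
    by (rule foldr_vtx_exch) (use 0 in auto)
  have 2: "?t = (z a - y) - (z (Suc a) - y)" by simp
  have 3: "exch ?t a 
     (\<lambda>w. vtx (z a - y) a (vtx (z (Suc a) - y) (Suc a) (foldr (\<lambda>r. vtx (z r - y) r) ?r ?g)) w d)
     (\<lambda>w. vtx (z (Suc a) - y) a (vtx (z a - y) (Suc a) (foldr (\<lambda>r. vtx (?z r - y) r) ?r ?g')) w d)" for d
    unfolding 2 by (rule vtx_exch_pair) (use 1 in simp)
  show ?thesis
    unfolding column_op_def l foldr_append
    by (rule foldr_vtx_exch) (use 3 in auto)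
qed

lemma layer_op_exch_row:
  assumes "exch (z a - z (Suc a)) a f f'" "1 \<le> a" "Suc a \<le> k"
  shows "exch (z a - z (Suc a)) a (layer_op z k vac y u n f)
     (layer_op (z \<circ> transpose a (Suc a)) k vac y u n f')"
proof (induction n)
  case 0
  then show ?case using assms(1) by simp
next
  case (Suc n)
  show ?case unfolding layer_op.simps by (rule column_op_exch_row[OF Suc assms(2,3)])
qed

section \<open>Exchange of two adjacent columns\<close>

text \<open>Two adjacent columns are processed row by row, with one vertical colour for each of them.\<close>

definition vtx1 ::
  "'a::field \<Rightarrow> nat \<Rightarrow> ((nat \<Rightarrow> nat) \<Rightarrow> nat \<Rightarrow> nat \<Rightarrow> 'a) \<Rightarrow> (nat \<Rightarrow> nat) \<Rightarrow> nat \<Rightarrow> nat \<Rightarrow> 'a" where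
  "vtx1 t r H = (\<lambda>w d e. vtx t r (\<lambda>w' d'. H w' d' e) w d)"

definition vtx2 ::
  "'a::field \<Rightarrow> nat \<Rightarrow> ((nat \<Rightarrow> nat) \<Rightarrow> nat \<Rightarrow> nat \<Rightarrow> 'a) \<Rightarrow> (nat \<Rightarrow> nat) \<Rightarrow> nat \<Rightarrow> nat \<Rightarrow> 'a" where
  "vtx2 t r H = (\<lambda>w d e. vtx t r (\<lambda>w' e'. H w' d e') w e)"

lemma foldr_vtx1:
  "foldr (\<lambda>r. vtx1 (c r) r) rs H w d e = foldr (\<lambda>r. vtx (c r) r) rs (\<lambda>w' d'. H w' d' e) w d"
  by (induction rs arbitrary: w d) (simp_all add: vtx1_def vtx_def)

lemma foldr_vtx2:
  "foldr (\<lambda>r. vtx2 (c r) r) rs H w d e = foldr (\<lambda>r. vtx (c r) r) rs (\<lambda>w' e'. H w' d e') w e"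
  by (induction rs arbitrary: w e) (simp_all add: vtx2_def vtx_def)

lemma foldr_vtx_mult_right:
  "foldr (\<lambda>r. vtx (c r) r) rs (\<lambda>w d. g w d * C) w d = foldr (\<lambda>r. vtx (c r) r) rs g w d * C"
  by (induction rs arbitrary: w d) (simp_all add: vtx_def algebra_simps)

lemma vtx2_vtx1_commute: "r \<noteq> r' \<Longrightarrow> vtx2 c r (vtx1 c' r' H) = vtx1 c' r' (vtx2 c r H)"
  by (auto simp: fun_eq_iff vtx1_def vtx2_def vtx_def algebra_simps fun_upd_twist)

lemma foldr_vtx2_vtx1_commute:
  "r \<notin> set rs \<Longrightarrow>
   foldr (\<lambda>r. vtx2 (c r) r) rs (vtx1 c' r H) = vtx1 c' r (foldr (\<lambda>r. vtx2 (c r) r) rs H)"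
  by (induction rs) (auto simp: vtx2_vtx1_commute)

text \<open>Vertices of different columns in different rows touch disjoint edges and commute, so
  column-by-column evaluation can be reordered row by row.\<close>

lemma foldr_vtx2_foldr_vtx1:
  "distinct rs \<Longrightarrow>
   foldr (\<lambda>r. vtx2 (c2 r) r) rs (foldr (\<lambda>r. vtx1 (c1 r) r) rs H) =
   foldr (\<lambda>r H. vtx2 (c2 r) r (vtx1 (c1 r) r H)) rs H"
  by (induction rs) (auto simp: foldr_vtx2_vtx1_commute)

lemma column_op_column_op:
  "column_op z k vac y2 (\<lambda>w. column_op z k vac y1 f w d) w e =
   foldr (\<lambda>r H. vtx2 (z r - y2) r (vtx1 (z r - y1) r H)) [1..<Suc k]
     (\<lambda>w d e. f w * of_bool (d = vac) * of_bool (e = vac)) w d e"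
proof -
  have "column_op z k vac y2 (\<lambda>w. column_op z k vac y1 f w d) w e =
     foldr (\<lambda>r. vtx2 (z r - y2) r) [1..<Suc k] (foldr (\<lambda>r. vtx1 (z r - y1) r) [1..<Suc k]
     (\<lambda>w d e. f w * of_bool (d = vac) * of_bool (e = vac))) w d e"
    unfolding column_op_def foldr_vtx2 foldr_vtx1 foldr_vtx_mult_right ..
  then show ?thesis
    by (simp add: foldr_vtx2_foldr_vtx1 del: upt_Suc)
qed

text \<open>Yang-Baxter equation for one row crossed by two columns. With \<open>c1\<close>,
  \<open>c2\<close> the row variable minus the column variables, \<open>c2 - c1\<close> is the same
  for every row, which lets the relation pass through all rows.\<close>

lemma vtx2_vtx1_exch:
  assumes "\<And>w d e. (c2 - c1 + 1) * H' w d e = (c2 - c1) * H w e d + H w d e"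
  shows "(c2 - c1 + 1) * vtx2 c1 r (vtx1 c2 r H') w d e =
     (c2 - c1) * vtx2 c2 r (vtx1 c1 r H) w e d + vtx2 c2 r (vtx1 c1 r H) w d e"
proof -
  define t where "t = c2 - c1"
  have c2: "c2 = t + c1" by (simp add: t_def)
  have 1: "(t + 1) * H' w d e = t * H w e d + H w d e" for w d e
    using assms by (simp add: t_def)
  have "(t + 1) * vtx2 c1 r (vtx1 c2 r H') w d e =
     c1 * (c2 * ((t + 1) * H' w d e) + (t + 1) * H' (w(r := d)) (w r) e) +
     (c2 * ((t + 1) * H' (w(r := e)) d (w r)) + (t + 1) * H' (w(r := d)) e (w r))"
    by (simp add: vtx1_def vtx2_def vtx_def algebra_simps)
  also have "\<dots> = t * vtx2 c2 r (vtx1 c1 r H) w e d + vtx2 c2 r (vtx1 c1 r H) w d e"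
    unfolding 1 by (simp add: c2 vtx1_def vtx2_def vtx_def algebra_simps)
  finally show ?thesis by (simp add: t_def)
qed

text \<open>Induction over the rows from the bottom. Below the last row both vertical colours must
  be the vacuum, a condition symmetric in them, so the relation starts as
  \<open>(t + 1) * H = t * H + H\<close>.\<close>

lemma column_op_exch_column:
  "(y1 - y2 + 1) * column_op z k vac y1 (\<lambda>w. column_op z k vac y2 f w d) w e =
   (y1 - y2) * column_op z k vac y2 (\<lambda>w. column_op z k vac y1 f w e) w d +
   column_op z k vac y2 (\<lambda>w. column_op z k vac y1 f w d) w e"
proof -
  have "(y1 - y2 + 1) * foldr (\<lambda>r H. vtx2 (z r - y1) r (vtx1 (z r - y2) r H)) rs H w d e =
     (y1 - y2) * foldr (\<lambda>r H. vtx2 (z r - y2) r (vtx1 (z r - y1) r H)) rs H w e d +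
     foldr (\<lambda>r H. vtx2 (z r - y2) r (vtx1 (z r - y1) r H)) rs H w d e"
    if "\<And>w d e. H w e d = H w d e" for H :: "(nat \<Rightarrow> nat) \<Rightarrow> nat \<Rightarrow> nat \<Rightarrow> 'a" and rs
  proof (induction rs arbitrary: w d e)
    case Nil
    show ?case using that[of w d e] by (simp add: algebra_simps)
  next
    case (Cons r rs)
    have t: "y1 - y2 = (z r - y2) - (z r - y1)" by simp
    show ?case
      using vtx2_vtx1_exch[OF Cons[unfolded t], where r=r and w=w and d=d and e=e] by simp
  qed
  then show ?thesis
    unfolding column_op_column_op by (simp del: upt_Suc)
qed

text \<open>Carries the exchange relation of two columns through the columns to their right.\<close>

lemma column_op_linear:
  assumes "\<And>w. C * f w = D * g w + h w"
  shows "C * column_op z k vac y f w d = D * column_op z k vac y g w d + column_op z k vac y h w d"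
proof -
  have "C * foldr (\<lambda>r. vtx (c r) r) rs F w d =
     D * foldr (\<lambda>r. vtx (c r) r) rs G w d + foldr (\<lambda>r. vtx (c r) r) rs H w d"
    if "\<And>w d. C * F w d = D * G w d + H w d" for F G H :: "(nat \<Rightarrow> nat) \<Rightarrow> nat \<Rightarrow> 'a" and c rs
  proof (induction rs arbitrary: w d)
    case Nil
    show ?case using that by simp
  next
    case (Cons r rs)
    have "C * foldr (\<lambda>r. vtx (c r) r) (r # rs) F w d =
       c r * (C * foldr (\<lambda>r. vtx (c r) r) rs F w d) + C * foldr (\<lambda>r. vtx (c r) r) rs F (w(r := d)) (w r)"
      by (simp add: vtx_def[of _ _ "foldr _ _ _"] algebra_simps)
    then show ?case unfolding Cons by (simp add: vtx_def[of _ _ "foldr _ _ _"] algebra_simps)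
  qed
  note * = this
  show ?thesis unfolding column_op_def
    by (rule *) (use assms in \<open>simp add: of_bool_def\<close>)
qed

lemma layer_op_cong:
  assumes "\<And>i. 1 \<le> i \<Longrightarrow> i \<le> n \<Longrightarrow> y i = y' i" "\<And>i. 1 \<le> i \<Longrightarrow> i \<le> n \<Longrightarrow> u i = u' i"
  shows "layer_op z k vac y u n f = layer_op z k vac y' u' n f"
  using assms by (induction n) auto

text \<open>Columns to the left of \<open>s\<close> are unaffected, the pair obeys
  \<open>column_op_exch_column\<close>, and the columns to the right act linearly.\<close>

lemma layer_op_exch_column:
  fixes y :: "nat \<Rightarrow> 'a::field"
  assumes "1 \<le> s" "Suc s \<le> n"
  defines "\<tau> \<equiv> transpose s (Suc s)"
  shows "(y s - y (Suc s) + 1) * layer_op z k vac (y \<circ> \<tau>) u n f w =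
     (y s - y (Suc s)) * layer_op z k vac y (u \<circ> \<tau>) n f w + layer_op z k vac y u n f w"
  using assms(2)
proof (induction n arbitrary: w rule: dec_induct)
  case base
  obtain s' where s': "s = Suc s'" using assms(1) by (cases s) auto
  have eq: "layer_op z k vac (y \<circ> \<tau>) u s' f = layer_op z k vac y u s' f"
    "layer_op z k vac y (u \<circ> \<tau>) s' f = layer_op z k vac y u s' f"
    by (rule layer_op_cong; auto simp: \<tau>_def s' transpose_def)+
  show ?case
    using column_op_exch_column[of "y s" "y (Suc s)" z k vac "layer_op z k vac y u s' f" "u s" w "u (Suc s)"]
    using eq by (simp add: s' \<tau>_def o_def)
next
  case (step n)
  have t: "\<tau> (Suc n) = Suc n" using step(1) by (auto simp: \<tau>_def transpose_def)
  show ?case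
    unfolding layer_op.simps o_apply t by (rule column_op_linear) (use step.IH in \<open>simp add: o_def\<close>)
qed

section \<open>One layer\<close>

text \<open>Every vertex conserves colours: without a vacuum among the right and top colours none is
  available for the bottom edge.\<close>

lemma foldr_vtx_no_vac:
  assumes "\<And>r. r \<in> set rs \<Longrightarrow> w r \<noteq> vac" "d \<noteq> vac"
  shows "foldr (\<lambda>r. vtx (c r) r) rs (\<lambda>w b. f w * of_bool (b = vac)) w d = 0"
  using assms by (induction rs arbitrary: w d) (auto simp: vtx_def[of _ _ "foldr _ _ _"])

text \<open>The vacuum has to run straight down. If it turned into the left edge of row
  \<open>r\<close>, another colour would continue downwards, and that term vanishes by
  \<open>foldr_vtx_no_vac\<close>.\<close>

lemma foldr_vtx_pass:
  assumes "\<And>r. r \<in> set rs \<Longrightarrow> w r \<noteq> vac" "distinct rs"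
  shows "foldr (\<lambda>r. vtx (c r) r) rs (\<lambda>w b. f w * of_bool (b = vac)) w vac =
    (\<Prod>r\<in>set rs. c r) * f w"
  using assms
proof (induction rs)
  case (Cons r rs)
  have "foldr (\<lambda>r. vtx (c r) r) rs (\<lambda>w b. f w * of_bool (b = vac)) (w(r := vac)) (w r) = 0"
    by (rule foldr_vtx_no_vac) (use Cons.prems in auto)
  then show ?case using Cons by (auto simp: vtx_def[of _ _ "foldr _ _ _"])
qed simp

lemma foldr_vtx_vac:
  assumes "\<And>r. r \<in> set rs \<Longrightarrow> w r = vac" "distinct rs"
  shows "foldr (\<lambda>r. vtx (c r) r) rs g w vac = (\<Prod>r\<in>set rs. c r + 1) * g w vac"
  using assms
proof (induction rs)
  case (Cons r rs)
  then have "w(r := vac) = w" by auto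
  then show ?case using Cons by (simp add: vtx_def[of _ _ "foldr _ _ _"] algebra_simps)
qed simp

text \<open>Either \<open>e\<close> crosses all rows (last term), or it turns into the left edge of
  some row \<open>r\<close>: the rows before \<open>r\<close> give \<open>c i\<close>, and behind it
  a vacuum runs down through vacuum rows, each giving \<open>c i + 1\<close>.\<close>

lemma foldr_vtx_emit:
  assumes "\<And>r. r \<in> {a..<b} \<Longrightarrow> w r = vac" "a \<le> b"
  shows "foldr (\<lambda>r. vtx (c r) r) [a..<b] g w e =
    (\<Sum>r\<in>{a..<b}. (\<Prod>i\<in>{a..<r}. c i) * (\<Prod>i\<in>{r<..<b}. c i + 1) * g (w(r := e)) vac) +
    (\<Prod>i\<in>{a..<b}. c i) * g w e"
  using assms(2,1)
proof (induction rule: inc_induct)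
  case (step a)
  have "foldr (\<lambda>r. vtx (c r) r) [Suc a..<b] g (w(a := e)) vac = 
    (\<Prod>i\<in>{a<..<b}. c i + 1) * g (w(a := e)) vac"
    using step by (subst foldr_vtx_vac) (auto intro!: arg_cong2[where f="(*)"] prod.cong)
  moreover have "(\<Prod>i\<in>{a..<r}. c i) = c a * (\<Prod>i\<in>{Suc a..<r}. c i)" if "r > a" for r
    using that by (simp add: prod.atLeast_Suc_lessThan)
  ultimately show ?case
    using step 
    by (simp add: upt_conv_Cons sum.atLeast_Suc_lessThan vtx_def[of _ _ "foldr _ _ _"] algebra_simps
        sum_distrib_left del: upt_Suc fun_upd_apply)
qed simp

lemma column_op_vac:
  assumes "t \<le> k" "\<And>r. r \<in> {1..t} \<Longrightarrow> w r = vac" "\<And>r. r \<in> {t<..k} \<Longrightarrow> w r \<noteq> vac"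
  shows "column_op z k vac y f w vac =
    (\<Prod>r\<in>{1..t}. z r - y + 1) * ((\<Prod>r\<in>{t<..k}. z r - y) * f w)"
proof -
  have l: "[1..<Suc k] = [1..<Suc t] @ [Suc t..<Suc k]"
    using assms(1) upt_add_eq_append[of 1 "Suc t" "k - t"] by (simp del: upt_Suc)
  have s: "set [1..<Suc t] = {1..t}" "set [Suc t..<Suc k] = {t<..k}" by auto
  show ?thesis
    unfolding column_op_def l foldr_append
    unfolding s[symmetric]
    by (subst foldr_vtx_vac, unfold s, erule assms(2), rule distinct_upt,
        subst foldr_vtx_pass, unfold s, erule assms(3), rule distinct_upt, rule refl)
qed

text \<open>If \<open>e\<close> crossed the first \<open>t\<close> rows, no vacuum could reach the
  bottom; so it leaves at some \<open>r \<le> t\<close>, and the vacuum released there passes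
  straight through the rows beyond \<open>t\<close>.\<close>

lemma column_op_emit:
  assumes "t \<le> k" "\<And>r. r \<in> {1..t} \<Longrightarrow> w r = vac" "\<And>r. r \<in> {t<..k} \<Longrightarrow> w r \<noteq> vac" "e \<noteq> vac"
  shows "column_op z k vac y f w e =
    (\<Sum>r\<in>{1..t}. (\<Prod>i\<in>{1..<r}. z i - y) * (\<Prod>i\<in>{r<..t}. z i - y + 1) * f (w(r := e))) *
    (\<Prod>r\<in>{t<..k}. z r - y)"
proof -
  have l: "[1..<Suc k] = [1..<Suc t] @ [Suc t..<Suc k]"
    using assms(1) upt_add_eq_append[of 1 "Suc t" "k - t"] by (simp del: upt_Suc)
  let ?G = "foldr (\<lambda>r. vtx (z r - y) r) [Suc t..<Suc k] (\<lambda>w b. f w * of_bool (b = vac))"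
  have s: "set [Suc t..<Suc k] = {t<..k}" by auto
  have 1: "?G (w(r := e)) vac = (\<Prod>r\<in>{t<..k}. z r - y) * f (w(r := e))" if "r \<in> {1..t}" for r
  proof -
    have "(w(r := e)) i \<noteq> vac" if "i \<in> set [Suc t..<Suc k]" for i
      using assms(3)[of i] assms(4) that unfolding s by auto
    then show ?thesis unfolding s[symmetric] by (intro foldr_vtx_pass distinct_upt)
  qed
  have 2: "?G w e = 0"
    using assms(3)[unfolded s[symmetric]] assms(4) by (rule foldr_vtx_no_vac)
  have 3: "{1..<Suc t} = {1..t}" "{r<..<Suc t} = {r<..t}" for r by auto
  have "column_op z k vac y f w e = 
    (\<Sum>r\<in>{1..t}. (\<Prod>i\<in>{1..<r}. z i - y) * (\<Prod>i\<in>{r<..t}. z i - y + 1) * ?G (w(r := e)) vac)"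
    unfolding column_op_def l foldr_append
    using foldr_vtx_emit[of 1 "Suc t" w vac "\<lambda>r. z r - y" ?G e, unfolded 3 2] assms(2)
    by (simp del: upt_Suc)
  also have "\<dots> = (\<Sum>r\<in>{1..t}. (\<Prod>i\<in>{1..<r}. z i - y) * (\<Prod>i\<in>{r<..t}. z i - y + 1) * f (w(r := e))) *
    (\<Prod>r\<in>{t<..k}. z r - y)"
    unfolding sum_distrib_right by (rule sum.cong) (auto simp: 1 mult_ac simp del: upt_Suc)
  finally show ?thesis .
qed

section \<open>Moving the emitted colour to the last vacuum row\<close>

text \<open>
  The coefficients in the expansion of the state with the only non-vacuum colour in row \<open>r\<close> (of the
  first \<open>T\<close>) in terms of the states with that colour in row \<open>T\<close>, carrying the variable \<open>z s\<close>.
\<close>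

definition hop :: "nat \<Rightarrow> (nat \<Rightarrow> 'a::field) \<Rightarrow> nat \<Rightarrow> nat \<Rightarrow> 'a" where
  "hop T z r s = (if s = r then 1 else 1 / (z s - z r)) *
     (\<Prod>i\<in>{r<..T} - {s}. (z s - z i + 1) / (z s - z i))"

lemma permutes_superset_fix:
  fixes T :: nat
  assumes "p permutes {1..T}" "p T = T"
  shows "p permutes {1..<T}"
proof (rule permutes_superset[OF assms(1)])
  fix i assume "i \<in> {1..T} - {1..<T}"
  then have "i = T" by auto
  then show "p i = i" using assms(2) by simp
qed

text \<open>
  The symmetry is assumed for \<open>\<Phi> T\<close> alone: the exchange relation does not imply it when
  \<open>z r - z (Suc r) + 1 = 0\<close>.
\<close>

lemma hop_expansion:
  fixes \<Phi> :: "nat \<Rightarrow> (nat \<Rightarrow> 'a::field) \<Rightarrow> 'a"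
  assumes ex: "\<And>r z. 1 \<le> r \<Longrightarrow> r < T \<Longrightarrow>
      (z r - z (Suc r) + 1) * \<Phi> (Suc r) (z \<circ> transpose r (Suc r)) =
      (z r - z (Suc r)) * \<Phi> r z + \<Phi> (Suc r) z"
    and sym: "\<And>z \<pi>. inj_on z {1..k} \<Longrightarrow> \<pi> permutes {1..<T} \<Longrightarrow> \<Phi> T (z \<circ> \<pi>) = \<Phi> T z"
    and z: "inj_on z {1..k}" and T: "T \<le> k" and r: "r \<le> T" "1 \<le> r"
  shows "\<Phi> r z = (\<Sum>s\<in>{r..T}. hop T z r s * \<Phi> T (z \<circ> transpose T s))"
  using r z
proof (induction arbitrary: z rule: inc_induct)
  case base
  then show ?case by (simp add: hop_def)
next
  case (step r)
  let ?z = "z \<circ> transpose r (Suc r)"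
  let ?S = "\<lambda>z s. \<Phi> T (z \<circ> transpose T s)"
  define d where "d = z r - z (Suc r)"
  have inj: "z i \<noteq> z j" if "i \<in> {1..k}" "j \<in> {1..k}" "i \<noteq> j" for i j
    using that step.prems by (auto dest: inj_onD)
  have d: "d \<noteq> 0" unfolding d_def using inj[of r "Suc r"] step T by auto
  have perm: "transpose r (Suc r) permutes {1..k}"
    by (rule permutes_swap_id) (use step T in auto)
  have injz: "inj_on ?z {1..k}"
    by (rule comp_inj_on) (use step.prems permutes_image[OF perm] permutes_inj_on[OF perm] in auto)
  \<comment> \<open>Both arguments put \<open>z s\<close> at position \<open>T\<close>, so they
    differ by a permutation of the first \<open>T - 1\<close> positions and \<open>sym\<close>
    applies.\<close>
  have S1: "?S ?z s = ?S z s" if "s \<in> {Suc r<..T}" for s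
  proof -
    have inj': "inj_on (z \<circ> transpose T s) {1..k}"
    proof -
      have "transpose T s permutes {1..k}"
        by (rule permutes_swap_id) (use that T step in auto)
      then show ?thesis
        by (intro comp_inj_on) (use step.prems in \<open>auto simp: permutes_image permutes_inj_on\<close>)
    qed
    let ?\<pi> = "transpose T s \<circ> transpose r (Suc r) \<circ> transpose T s"
    have "?\<pi> permutes {1..T}"
      by (intro permutes_compose permutes_swap_id) (use that step in auto)
    moreover have "?\<pi> T = T" using that by (auto simp: transpose_def)
    ultimately have "?\<pi> permutes {1..<T}"
      by (rule permutes_superset_fix)
    from sym[OF inj' this] show ?thesis
      by (simp add: o_def)
  qed
  \<comment> \<open>After the swap, position \<open>Suc r\<close> holds \<open>z r\<close>, so again
    the same variable sits at \<open>T\<close>.\<close>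
  have S2: "?S ?z (Suc r) = ?S z r"
  proof -
    have inj': "inj_on (z \<circ> transpose T r) {1..k}"
    proof -
      have "transpose T r permutes {1..k}"
        by (rule permutes_swap_id) (use T step in auto)
      then show ?thesis
        by (intro comp_inj_on) (use step.prems in \<open>auto simp: permutes_image permutes_inj_on\<close>)
    qed
    let ?\<pi> = "transpose T r \<circ> transpose r (Suc r) \<circ> transpose T (Suc r)"
    have "?\<pi> permutes {1..T}"
      by (intro permutes_compose permutes_swap_id) (use step in auto)
    moreover have "?\<pi> T = T" using step by (auto simp: transpose_def)
    ultimately have "?\<pi> permutes {1..<T}"
      by (rule permutes_superset_fix)
    from sym[OF inj' this] show ?thesis
      by (simp add: o_def)
  qed
  \<comment> \<open>With \<open>A = z s - z (Suc r)\<close> this is the partial fraction identity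
    \<open>(d + 1) / (A - d) - 1 / A = d * (A + 1) / (A * (A - d))\<close>; the factor
    \<open>(A + 1) / A\<close> is the new one for \<open>i = Suc r\<close>.\<close>
  have K: "(d + 1) * hop T ?z (Suc r) s - hop T z (Suc r) s = d * hop T z r s" if s: "s \<in> {Suc r<..T}" for s
  proof -
    define P where "P = (\<Prod>i\<in>{Suc r<..T} - {s}. (z s - z i + 1) / (z s - z i))"
    have zs: "?z s = z s" "?z (Suc r) = z r" using s by (auto simp: transpose_def)
    have "(\<Prod>i\<in>{Suc r<..T} - {s}. (?z s - ?z i + 1) / (?z s - ?z i)) = P"
      unfolding P_def by (rule prod.cong) (use s in \<open>auto simp: transpose_def\<close>)
    then have h1: "hop T ?z (Suc r) s = P / (z s - z r)"
      unfolding hop_def zs using s by simp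
    have h2: "hop T z (Suc r) s = P / (z s - z (Suc r))"
      unfolding hop_def P_def using s by simp
    have "{r<..T} - {s} = insert (Suc r) ({Suc r<..T} - {s})" using s by auto
    then have h3: "hop T z r s = ((z s - z (Suc r) + 1) / (z s - z (Suc r))) * P / (z s - z r)"
      unfolding hop_def P_def using s by simp
    have n: "z s - z r \<noteq> 0" "z s - z (Suc r) \<noteq> 0" using s inj[of s r] inj[of s "Suc r"] T step by auto
    show ?thesis
      unfolding h1 h2 h3 d_def using n by (simp add: field_simps)
  qed
  \<comment> \<open>The two remaining variables have one source each: \<open>z r\<close> at position
    \<open>T\<close> arises only from the swapped list, \<open>z (Suc r)\<close> only from the
    original one.\<close>
  have h0: "(d + 1) * hop T ?z (Suc r) (Suc r) = d * hop T z r r"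
  proof -
    have "{r<..T} - {r} = insert (Suc r) ({Suc r<..T} - {Suc r})" using step by auto
    moreover have "(\<Prod>i\<in>{Suc r<..T} - {Suc r}. (z r - ?z i + 1) / (z r - ?z i)) =
      (\<Prod>i\<in>{Suc r<..T} - {Suc r}. (z r - z i + 1) / (z r - z i))"
      by (rule prod.cong) (auto simp: transpose_def)
    moreover have "?z (Suc r) = z r" by simp
    ultimately show ?thesis unfolding hop_def using d by (simp add: d_def)
  qed
  have h1: "- hop T z (Suc r) (Suc r) = d * hop T z r (Suc r)"
  proof -
    have "z (Suc r) - z r = - d" by (simp add: d_def)
    moreover have "{r<..T} - {Suc r} = {Suc r<..T} - {Suc r}" by auto
    ultimately show ?thesis unfolding hop_def using d by simp
  qed
  have set1: "{Suc r..T} = insert (Suc r) {Suc r<..T}" "{r..T} = insert r (insert (Suc r) {Suc r<..T})"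
    using step by auto
  \<comment> \<open>The exchange relation is solved for \<open>\<Phi> r z\<close>; the induction
    hypothesis for \<open>Suc r\<close> then expands both lists.\<close>
  have "d * \<Phi> r z = (d + 1) * \<Phi> (Suc r) ?z - \<Phi> (Suc r) z"
    using ex[of r z] step by (simp add: d_def)
  also have "\<dots> = (d + 1) * (\<Sum>s\<in>{Suc r..T}. hop T ?z (Suc r) s * ?S ?z s) -
      (\<Sum>s\<in>{Suc r..T}. hop T z (Suc r) s * ?S z s)"
    by (simp only: step.IH[OF le_SucI[OF step.prems(1)] injz] step.IH[OF le_SucI[OF step.prems(1)] step.prems(2)])
  also have "\<dots> = (d + 1) * (hop T ?z (Suc r) (Suc r) * ?S ?z (Suc r)) -
      hop T z (Suc r) (Suc r) * ?S z (Suc r) +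
      ((d + 1) * (\<Sum>s\<in>{Suc r<..T}. hop T ?z (Suc r) s * ?S ?z s) -
      (\<Sum>s\<in>{Suc r<..T}. hop T z (Suc r) s * ?S z s))"
    unfolding set1 by (simp add: algebra_simps del: comp_apply)
  also have "(d + 1) * (\<Sum>s\<in>{Suc r<..T}. hop T ?z (Suc r) s * ?S ?z s) -
      (\<Sum>s\<in>{Suc r<..T}. hop T z (Suc r) s * ?S z s) =
      (\<Sum>s\<in>{Suc r<..T}. ((d + 1) * hop T ?z (Suc r) s - hop T z (Suc r) s) * ?S z s)"
    unfolding sum_distrib_left sum_subtractf[symmetric]
    by (rule sum.cong[OF refl]) (simp only: S1 left_diff_distrib mult.assoc)
  also have "\<dots> = (\<Sum>s\<in>{Suc r<..T}. d * (hop T z r s * ?S z s))"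
    by (rule sum.cong[OF refl]) (simp only: K mult.assoc)
  also have "(d + 1) * (hop T ?z (Suc r) (Suc r) * ?S ?z (Suc r)) -
      hop T z (Suc r) (Suc r) * ?S z (Suc r) =
      ((d + 1) * hop T ?z (Suc r) (Suc r)) * ?S z r + (- hop T z (Suc r) (Suc r)) * ?S z (Suc r)"
    by (simp only: S2) (simp add: algebra_simps)
  also have "\<dots> = d * (hop T z r r * ?S z r) + d * (hop T z r (Suc r) * ?S z (Suc r))"
    unfolding h0 h1 by (simp add: algebra_simps)
  also have "\<dots> + (\<Sum>s\<in>{Suc r<..T}. d * (hop T z r s * ?S z s)) =
    d * (\<Sum>s\<in>{r..T}. hop T z r s * ?S z s)"
    unfolding set1 by (simp add: algebra_simps sum_distrib_left)
  finally show ?case unfolding mult_left_cancel[OF d] .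
qed

text \<open>The sum telescopes: \<open>Q r\<close> has the plain column weights before
  \<open>r\<close> and the target factors \<open>p i\<close> from \<open>r\<close> to
  \<open>s\<close>. The summand at \<open>s\<close> is \<open>Q s * R\<close>, the others are
  \<open>(Q r - Q (Suc r)) * R\<close>, and \<open>Q 1 * R\<close> is the product on the
  right.\<close>

lemma hop_telescope:
  fixes z :: "nat \<Rightarrow> 'a::field"
  assumes inj: "inj_on z {1..T}" and s: "s \<in> {1..T}"
  shows "(\<Sum>r\<in>{1..s}. (\<Prod>i\<in>{1..<r}. z i - y) * (\<Prod>i\<in>{r<..T}. z i - y + 1) * hop T z r s) =
    (\<Prod>i\<in>{1..T} - {s}. (z i - y + 1) * ((z s - z i + 1) / (z s - z i)))"
proof -
  define p where "p i = (z i - y + 1) * ((z s - z i + 1) / (z s - z i))" for i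
  define Q where "Q r = (\<Prod>i\<in>{1..<r}. z i - y) * (\<Prod>i\<in>{r..<s}. p i)" for r
  define R where "R = (\<Prod>i\<in>{s<..T}. p i)"
  have ne: "z s - z i \<noteq> 0" if "i \<in> {1..T}" "i \<noteq> s" for i
    using that inj s by (auto dest: inj_onD)
  have pR: "(\<Prod>i\<in>{s<..T}. z i - y + 1) * (\<Prod>i\<in>{s<..T}. (z s - z i + 1) / (z s - z i)) = R"
    unfolding R_def p_def prod.distrib ..
  have last: "(\<Prod>i\<in>{1..<s}. z i - y) * (\<Prod>i\<in>{s<..T}. z i - y + 1) * hop T z s s = Q s * R"
  proof -
    have "{s<..T} - {s} = {s<..T}" by auto
    then show ?thesis unfolding hop_def Q_def using pR by simp
  qed
  have summand: "(\<Prod>i\<in>{1..<r}. z i - y) * (\<Prod>i\<in>{r<..T}. z i - y + 1) * hop T z r s =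
      (Q r - Q (Suc r)) * R" if r: "r \<in> {1..<s}" for r
  proof -
    define B where "B = (\<Prod>i\<in>{Suc r..<s}. p i)"
    define A where "A = (\<Prod>i\<in>{1..<r}. z i - y)"
    have n: "z s - z r \<noteq> 0" using ne[of r] r s by auto
    have i1: "{r<..T} = insert s ({Suc r..<s} \<union> {s<..T})" using r s by auto
    have 1: "(\<Prod>i\<in>{r<..T}. z i - y + 1) =
      (z s - y + 1) * ((\<Prod>i\<in>{Suc r..<s}. z i - y + 1) * (\<Prod>i\<in>{s<..T}. z i - y + 1))"
      unfolding i1 by (subst prod.insert; (subst prod.union_disjoint)?) auto
    have i2: "{r<..T} - {s} = {Suc r..<s} \<union> {s<..T}" using r s by auto
    have 2: "(\<Prod>i\<in>{r<..T} - {s}. (z s - z i + 1) / (z s - z i)) =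
      (\<Prod>i\<in>{Suc r..<s}. (z s - z i + 1) / (z s - z i)) * (\<Prod>i\<in>{s<..T}. (z s - z i + 1) / (z s - z i))"
      unfolding i2 by (subst prod.union_disjoint) auto
    have 3: "(\<Prod>i\<in>{Suc r..<s}. z i - y + 1) * (\<Prod>i\<in>{Suc r..<s}. (z s - z i + 1) / (z s - z i)) = B"
      unfolding B_def p_def prod.distrib ..
    have rs: "s \<noteq> r" using r by auto
    have ring: "(e * (b1 * c1)) * (1 / d * (b2 * c2)) = e / d * (b1 * b2) * (c1 * c2)"
      for b1 b2 c1 c2 d e :: 'a by simp
    have "(\<Prod>i\<in>{r<..T}. z i - y + 1) * hop T z r s = (z s - y + 1) / (z s - z r) *
        ((\<Prod>i\<in>{Suc r..<s}. z i - y + 1) * (\<Prod>i\<in>{Suc r..<s}. (z s - z i + 1) / (z s - z i))) *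
        ((\<Prod>i\<in>{s<..T}. z i - y + 1) * (\<Prod>i\<in>{s<..T}. (z s - z i + 1) / (z s - z i)))"
      unfolding hop_def 1 2 if_not_P[OF rs] by (rule ring)
    also have "\<dots> = (z s - y + 1) / (z s - z r) * B * R" unfolding 3 pR ..
    finally have L: "(\<Prod>i\<in>{1..<r}. z i - y) * (\<Prod>i\<in>{r<..T}. z i - y + 1) * hop T z r s =
      A * ((z s - y + 1) / (z s - z r) * B * R)" unfolding A_def by (simp only: mult.assoc)
    have Q1: "Q r = A * (p r * B)"
      unfolding Q_def A_def B_def using r by (simp add: prod.atLeast_Suc_lessThan)
    have Q2: "Q (Suc r) = A * (z r - y) * B"
      unfolding Q_def A_def B_def using r by simp
    \<comment> \<open>This identity drives the telescoping: exchanging \<open>p r\<close> for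
      \<open>z r - y\<close> costs exactly the factor contributed by row \<open>s\<close> and the
      pole of \<open>hop\<close>.\<close>
    have X: "p r - (z r - y) = (z s - y + 1) / (z s - z r)"
      unfolding p_def using n by (simp add: field_simps)
    have "Q r - Q (Suc r) = A * ((p r - (z r - y)) * B)"
      unfolding Q1 Q2 by (simp add: algebra_simps)
    then show ?thesis unfolding L X by (simp only: mult.assoc)
  qed
  have "{1..s} = insert s {1..<s}" using s by auto
  then have "(\<Sum>r\<in>{1..s}. (\<Prod>i\<in>{1..<r}. z i - y) * (\<Prod>i\<in>{r<..T}. z i - y + 1) * hop T z r s) =
    Q s * R + (\<Sum>r\<in>{1..<s}. (Q r - Q (Suc r)) * R)"
    using last summand by simp
  also have "\<dots> = Q s * R - (\<Sum>r\<in>{1..<s}. Q (Suc r) - Q r) * R"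
    by (simp add: sum_distrib_right sum_subtractf left_diff_distrib)
  also have "(\<Sum>r\<in>{1..<s}. Q (Suc r) - Q r) = Q s - Q 1"
    by (rule sum_Suc_diff') (use s in auto)
  also have "Q s * R - (Q s - Q 1) * R = (\<Prod>i\<in>{1..<s}. p i) * R"
    by (simp add: Q_def algebra_simps)
  also have "\<dots> = (\<Prod>i\<in>{1..<s} \<union> {s<..T}. p i)"
    unfolding R_def by (subst prod.union_disjoint) auto
  also have "{1..<s} \<union> {s<..T} = {1..T} - {s}" using s by auto
  finally show ?thesis by (simp add: p_def)
qed

text \<open>Turns the choice of the emitting row into a choice of the variable carried by row
  \<open>T\<close>. Each \<open>\<Phi> r\<close> is expanded by \<open>hop_expansion\<close>; after
  interchanging the sums, \<open>hop_telescope\<close> evaluates the coefficient for each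
  \<open>s\<close>.\<close>

lemma one_particle:
  fixes \<Phi> :: "nat \<Rightarrow> (nat \<Rightarrow> 'a::field) \<Rightarrow> 'a"
  assumes ex: "\<And>r z. 1 \<le> r \<Longrightarrow> r < T \<Longrightarrow>
      (z r - z (Suc r) + 1) * \<Phi> (Suc r) (z \<circ> transpose r (Suc r)) =
      (z r - z (Suc r)) * \<Phi> r z + \<Phi> (Suc r) z"
    and sym: "\<And>z \<pi>. inj_on z {1..k} \<Longrightarrow> \<pi> permutes {1..<T} \<Longrightarrow> \<Phi> T (z \<circ> \<pi>) = \<Phi> T z"
    and z: "inj_on z {1..k}" and T: "T \<le> k"
  shows "(\<Sum>r\<in>{1..T}. (\<Prod>i\<in>{1..<r}. z i - y) * (\<Prod>i\<in>{r<..T}. z i - y + 1) * \<Phi> r z) =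
    (\<Sum>s\<in>{1..T}. (\<Prod>i\<in>{1..T} - {s}. (z i - y + 1) * ((z s - z i + 1) / (z s - z i))) *
       \<Phi> T (z \<circ> transpose T s))"
proof -
  let ?c = "\<lambda>r. (\<Prod>i\<in>{1..<r}. z i - y) * (\<Prod>i\<in>{r<..T}. z i - y + 1)"
  have "(\<Sum>r\<in>{1..T}. ?c r * \<Phi> r z) =
    (\<Sum>r\<in>{1..T}. \<Sum>s\<in>{r..T}. ?c r * hop T z r s * \<Phi> T (z \<circ> transpose T s))"
  proof (rule sum.cong[OF refl])
    fix r assume "r \<in> {1..T}"
    then have "\<Phi> r z = (\<Sum>s\<in>{r..T}. hop T z r s * \<Phi> T (z \<circ> transpose T s))"
      by (intro hop_expansion[where \<Phi>=\<Phi>, OF ex sym z T]) auto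
    then show "?c r * \<Phi> r z = (\<Sum>s\<in>{r..T}. ?c r * hop T z r s * \<Phi> T (z \<circ> transpose T s))"
      by (simp only: sum_distrib_left mult.assoc)
  qed
  also have "\<dots> = (\<Sum>s\<in>{1..T}. \<Sum>r\<in>{1..s}. ?c r * hop T z r s * \<Phi> T (z \<circ> transpose T s))"
    unfolding sum.Sigma[OF finite_atLeastAtMost ballI[OF finite_atLeastAtMost]]
    by (rule sum.reindex_bij_witness[of _ "\<lambda>(s, r). (r, s)" "\<lambda>(r, s). (s, r)"]) auto
  also have "\<dots> = (\<Sum>s\<in>{1..T}. (\<Prod>i\<in>{1..T} - {s}. (z i - y + 1) * ((z s - z i + 1) / (z s - z i))) *
       \<Phi> T (z \<circ> transpose T s))"
    unfolding sum_distrib_right[symmetric]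
    using hop_telescope[OF inj_on_subset[OF z], of T] T by (intro sum.cong) auto
  finally show ?thesis .
qed

section \<open>A layer as a sum over permutations\<close>

lemma inj_on_comp_permutes: "inj_on z A \<Longrightarrow> p permutes A \<Longrightarrow> inj_on (z \<circ> p) A"
  by (metis comp_inj_on permutes_image permutes_inj_on)

lemma pair_factor_0 [simp]: "layers.pair_factor 0 z = 1"
  by (auto simp: layers.pair_factor_def intro!: prod.neutral)

lemma pair_factor_Suc:
  "layers.pair_factor (Suc n) z =
   layers.pair_factor n z * (\<Prod>a=1..n. (z a - z (Suc n) - 1) / (z a - z (Suc n)))"
proof -
  let ?P = "\<lambda>n. {(a, b). 1 \<le> a \<and> a < b \<and> b \<le> (n::nat)}"
  let ?g = "\<lambda>(a, b). (z a - z b - 1) / (z a - z b)"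
  have "finite (?P n)" for n
    by (rule finite_subset[of _ "{..n} \<times> {..n}"]) auto
  moreover have "?P (Suc n) = ?P n \<union> (\<lambda>a. (a, Suc n)) ` {1..n}"
    by (auto simp: le_Suc_eq image_iff)
  moreover have "?P n \<inter> (\<lambda>a. (a, Suc n)) ` {1..n} = {}" by auto
  ultimately have "prod ?g (?P (Suc n)) = prod ?g (?P n) * prod ?g ((\<lambda>a. (a, Suc n)) ` {1..n})"
    by (simp add: prod.union_disjoint)
  also have "prod ?g ((\<lambda>a. (a, Suc n)) ` {1..n}) = (\<Prod>a=1..n. (z a - z (Suc n) - 1) / (z a - z (Suc n)))"
    by (subst prod.reindex) (auto simp: inj_on_def)
  finally show ?thesis by (simp add: layers.pair_factor_def)
qed

text \<open>The contribution of one row to \<open>W\<close>: column \<open>I a\<close> itself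
  contributes 1, the columns on its two sides the two kinds of straight weights.\<close>

definition row_factor ::
  "(nat \<Rightarrow> nat) \<Rightarrow> (nat \<Rightarrow> 'a::field) \<Rightarrow> (nat \<Rightarrow> 'a) \<Rightarrow> nat \<Rightarrow> nat \<Rightarrow> 'a" where
  "row_factor I z y n a = (\<Prod>i=1..I a - 1. z a - y i) * (\<Prod>i=I a + 1..n. z a - y i + 1)"

lemma row_factor_Suc:
  "I a \<le> n \<Longrightarrow> row_factor I z y (Suc n) a = row_factor I z y n a * (z a - y (Suc n) + 1)"
  by (simp add: row_factor_def)

lemma row_factor_last: "I a = Suc n \<Longrightarrow> row_factor I z y (Suc n) a = (\<Prod>i=1..n. z a - y i)"
  by (simp add: row_factor_def)

text \<open>A column with non-vacuum top leaves a non-vacuum colour in row \<open>t\<close>, so the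
  induction over columns needs all \<open>t \<le> k\<close>; rows beyond \<open>t\<close> only
  collect the final product. The initial function is a family indexed by \<open>z\<close> because
  the exchange relation permutes the row variables.\<close>

theorem layer_op_formula:
  fixes f :: "(nat \<Rightarrow> 'a::field) \<Rightarrow> (nat \<Rightarrow> nat) \<Rightarrow> 'a"
  assumes ex: "\<And>a z. 1 \<le> a \<Longrightarrow> Suc a \<le> k \<Longrightarrow>
      exch (z a - z (Suc a)) a (f z) (f (z \<circ> transpose a (Suc a)))"
    and "t \<le> k" "strict_mono_on {1..t} I" "I ` {1..t} = {i \<in> {1..n}. u i \<noteq> vac}"
    and "\<And>r. r \<in> {1..t} \<Longrightarrow> w r = vac" "\<And>r. r \<in> {t<..k} \<Longrightarrow> w r \<noteq> vac"
    and "inj_on z {1..k}"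
  shows "layer_op z k vac y u n (f z) w =
    (\<Sum>\<tau> | \<tau> permutes {1..t}. f (z \<circ> \<tau>) (\<lambda>r. if r \<in> {1..t} then u (I r) else w r) *
       (\<Prod>a=1..t. row_factor I (z \<circ> \<tau>) y n a) * layers.pair_factor t (z \<circ> \<tau>)) *
    (\<Prod>a\<in>{t<..k}. \<Prod>i=1..n. z a - y i)"
  using assms(2-)
proof (induction n arbitrary: t w z)
  case 0
  then have "t = 0" by auto
  then show ?case by simp
next
  case (Suc n)
  let ?G = "\<lambda>t w z n \<tau>. f (z \<circ> \<tau>) (\<lambda>r. if r \<in> {1..t} then u (I r) else w r) *
       (\<Prod>a=1..t. row_factor I (z \<circ> \<tau>) y n a) * layers.pair_factor t (z \<circ> \<tau>)"
  let ?D = "\<lambda>t z n. \<Prod>a\<in>{t<..k}. \<Prod>i=1..n. z a - y i"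
  let ?y = "y (Suc n)"
  show ?case
  proof (cases "u (Suc n) = vac")
    \<comment> \<open>The scalar of a vacuum column is symmetric in the first \<open>t\<close>
      variables, hence equals the product of the new row factors in every summand.\<close>
    case True
    have im: "I ` {1..t} = {i \<in> {1..n}. u i \<noteq> vac}"
      using Suc.prems(3) True by (auto simp: le_Suc_eq)
    have le: "I a \<le> n" if "a \<in> {1..t}" for a
      using imageI[OF that, of I] unfolding im by simp
    have G: "?G t w z (Suc n) \<tau> = ?G t w z n \<tau> * (\<Prod>a=1..t. z a - ?y + 1)" if "\<tau> permutes {1..t}" for \<tau>
    proof -
      have "(\<Prod>a=1..t. row_factor I (z \<circ> \<tau>) y (Suc n) a) =
        (\<Prod>a=1..t. row_factor I (z \<circ> \<tau>) y n a * ((z \<circ> \<tau>) a - ?y + 1))"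
        by (rule prod.cong) (auto simp: row_factor_Suc le)
      also have "\<dots> = (\<Prod>a=1..t. row_factor I (z \<circ> \<tau>) y n a) * (\<Prod>a=1..t. z a - ?y + 1)"
        using prod.permute[OF that, of "\<lambda>a. z a - ?y + 1"] by (simp add: prod.distrib o_def)
      finally show ?thesis by simp
    qed
    have "layer_op z k vac y u (Suc n) (f z) w = (\<Prod>r=1..t. z r - ?y + 1) * ((\<Prod>r\<in>{t<..k}. z r - ?y) *
      layer_op z k vac y u n (f z) w)"
      using True column_op_vac[OF Suc.prems(1,4,5)] by simp
    also have "\<dots> = (\<Prod>r=1..t. z r - ?y + 1) * ((\<Prod>r\<in>{t<..k}. z r - ?y) *
       ((\<Sum>\<tau> | \<tau> permutes {1..t}. ?G t w z n \<tau>) * ?D t z n))"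
      by (simp only: Suc.IH[OF Suc.prems(1,2) im Suc.prems(4,5,6)])
    also have "\<dots> = (\<Sum>\<tau> | \<tau> permutes {1..t}. ?G t w z n \<tau> * (\<Prod>a=1..t. z a - ?y + 1)) *
        (?D t z n * (\<Prod>r\<in>{t<..k}. z r - ?y))"
      unfolding sum_distrib_right[symmetric] by (simp only: mult_ac)
    also have "?D t z n * (\<Prod>r\<in>{t<..k}. z r - ?y) = ?D t z (Suc n)"
      by (simp add: prod.distrib)
    also have "(\<Sum>\<tau> | \<tau> permutes {1..t}. ?G t w z n \<tau> * (\<Prod>a=1..t. z a - ?y + 1)) =
       (\<Sum>\<tau> | \<tau> permutes {1..t}. ?G t w z (Suc n) \<tau>)"
      by (rule sum.cong[OF refl], subst G) auto
    finally show ?thesis .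
  next
    case False
    define e where "e = u (Suc n)"
    have e: "e \<noteq> vac" using False by (simp add: e_def)
    have "Suc n \<in> I ` {1..t}" unfolding Suc.prems(3) using False by simp
    then obtain T where T: "T \<in> {1..t}" "I T = Suc n" by auto
    \<comment> \<open>\<open>I\<close> is increasing, so the rightmost non-vacuum column belongs to
      the last vacuum row.\<close>
    have "T = t"
    proof (rule ccontr)
      assume "T \<noteq> t"
      then have "I T < I t" using T(1) by (intro strict_mono_onD[OF Suc.prems(2)]) auto
      moreover have "I t \<in> {1..Suc n}" using Suc.prems(3) T(1) by auto
      ultimately show False using T by auto
    qed
    with T obtain t' where t': "t = Suc t'" "I t = Suc n" by (cases t) auto
    have lt: "I a < Suc n" if "a \<in> {1..t'}" for a
      using strict_mono_onD[OF Suc.prems(2), of a t] that t' by auto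
    have s1: "{1..t} = insert t {1..t'}" "t \<notin> {1..t'}" using t' by auto
    have im: "I ` {1..t'} = {i \<in> {1..n}. u i \<noteq> vac}"
    proof -
      have "I ` {1..t'} = I ` {1..t} - {Suc n}" unfolding s1 using t' lt by force
      also have "\<dots> = {i \<in> {1..n}. u i \<noteq> vac}" unfolding Suc.prems(3) by auto
      finally show ?thesis .
    qed
    have mono': "strict_mono_on {1..t'} I" using Suc.prems(2) t' by (auto simp: strict_mono_on_def)
    have tk: "t' \<le> k" using Suc.prems(1) t' by simp
    \<comment> \<open>The state to the left of column \<open>Suc n\<close> when row \<open>r\<close>
      has emitted \<open>e\<close>. The induction hypothesis reaches only \<open>r = t\<close>,
      where the first \<open>t'\<close> rows still carry the vacuum; \<open>one_particle\<close>
      handles the other rows.\<close>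
    define \<Phi> where "\<Phi> r z = layer_op z k vac y u n (f z) (w(r := e))" for r z
    have IH: "\<Phi> t z = (\<Sum>\<tau> | \<tau> permutes {1..t'}. ?G t' (w(t := e)) z n \<tau>) * ?D t' z n"
      if "inj_on z {1..k}" for z
      unfolding \<Phi>_def
      by (rule Suc.IH[OF tk mono' im _ _ that]) (use Suc.prems t' e in auto)
    have phi_ex: "(z r - z (Suc r) + 1) * \<Phi> (Suc r) (z \<circ> transpose r (Suc r)) =
      (z r - z (Suc r)) * \<Phi> r z + \<Phi> (Suc r) z" if r: "1 \<le> r" "r < t" for r z
    proof -
      have "w r = vac" "w (Suc r) = vac" using Suc.prems(4) r by auto
      then have "w(Suc r := e) \<circ> transpose r (Suc r) = w(r := e)"
        unfolding comp_transpose_upds by (auto simp: fun_eq_iff)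
      moreover have "exch (z r - z (Suc r)) r (layer_op z k vac y u n (f z))
        (layer_op (z \<circ> transpose r (Suc r)) k vac y u n (f (z \<circ> transpose r (Suc r))))"
        by (intro layer_op_exch_row ex) (use r Suc.prems(1) in auto)
      ultimately show ?thesis
        unfolding exch_def \<Phi>_def by metis
    qed
    \<comment> \<open>By the induction hypothesis this is a sum over all permutations of
      \<open>{1..t'}\<close>, and composing with \<open>\<pi>\<close> only reorders the
      summands.\<close>
    have phi_sym: "\<Phi> t (z \<circ> \<pi>) = \<Phi> t z" if inj: "inj_on z {1..k}" and \<pi>: "\<pi> permutes {1..<t}" for z \<pi>
    proof -
      have \<pi>': "\<pi> permutes {1..t'}" using \<pi> t' by (simp add: atLeastLessThanSuc_atLeastAtMost)
      have D: "?D t' (z \<circ> \<pi>) n = ?D t' z n"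
        by (rule prod.cong) (auto simp: permutes_not_in[OF \<pi>'])
      have "\<Phi> t (z \<circ> \<pi>) = (\<Sum>\<tau> | \<tau> permutes {1..t'}. ?G t' (w(t := e)) (z \<circ> \<pi>) n \<tau>) * ?D t' z n"
        by (subst IH[OF inj_on_comp_permutes[OF inj]], rule permutes_subset[OF \<pi>'], use tk in simp, simp only: D)
      also have "(\<Sum>\<tau> | \<tau> permutes {1..t'}. ?G t' (w(t := e)) (z \<circ> \<pi>) n \<tau>) =
        (\<Sum>\<tau> | \<tau> permutes {1..t'}. ?G t' (w(t := e)) z n (\<pi> \<circ> \<tau>))"
        by (simp only: o_assoc)
      also have "\<dots> = (\<Sum>\<tau> | \<tau> permutes {1..t'}. ?G t' (w(t := e)) z n \<tau>)"
        by (rule setum_permutations_compose_left[OF \<pi>', symmetric])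
      finally show ?thesis unfolding IH[OF inj] .
    qed
    let ?c = "\<lambda>r. if r \<in> {1..t} then u (I r) else w r"
    have c: "(\<lambda>r. if r \<in> {1..t'} then u (I r) else (w(t := e)) r) = ?c"
      using t' by (auto simp: fun_eq_iff e_def)
    \<comment> \<open>Each permutation of \<open>{1..t}\<close> is uniquely
      \<open>transpose t s \<circ> q\<close> with \<open>q\<close> permuting \<open>{1..t'}\<close>;
      this compares the summands under that decomposition.\<close>
    have G: "?G t w z (Suc n) (transpose t s \<circ> q) * ?D t z (Suc n) =
      (\<Prod>i\<in>{1..t} - {s}. (z i - ?y + 1) * ((z s - z i + 1) / (z s - z i))) *
       (?G t' (w(t := e)) (z \<circ> transpose t s) n q * ?D t' (z \<circ> transpose t s) n) * (\<Prod>r\<in>{t<..k}. z r - ?y)"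
      if s: "s \<in> {1..t}" and q: "q permutes {1..t'}" for s q
    proof -
      define \<pi> where "\<pi> = transpose t s \<circ> q"
      define x where "x = z \<circ> \<pi>"
      have perm: "\<pi> permutes {1..t}"
        unfolding \<pi>_def by (rule permutes_compose[OF permutes_subset[OF q] permutes_swap_id]) (use s t' in auto)
      have \<pi>t: "\<pi> t = s" unfolding \<pi>_def using permutes_not_in[OF q] t' by simp
      have bij: "bij_betw \<pi> {1..t'} ({1..t} - {s})"
      proof -
        have "\<pi> ` {1..t'} = \<pi> ` {1..t} - {\<pi> t}"
        proof -
          have "{1..t'} = {1..t} - {t}" using t' by auto
          then show ?thesis by (simp only: image_set_diff[OF permutes_inj[OF perm]] image_insert image_empty)
        qed
        then show ?thesis unfolding bij_betw_def permutes_image[OF perm] \<pi>t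
          using permutes_inj_on[OF perm] by blast
      qed
      \<comment> \<open>Row \<open>t\<close> now carries \<open>z s\<close> and counts among the
        non-vacuum rows; its part of the product is the row factor for
        \<open>I t = Suc n\<close>.\<close>
      have zD: "?D t' (z \<circ> transpose t s) n = (\<Prod>i=1..n. z s - y i) * ?D t z n"
      proof -
        have "{t'<..k} = insert t {t<..k}" using Suc.prems(1) t' by auto
        then have "?D t' (z \<circ> transpose t s) n = (\<Prod>i=1..n. z s - y i) * ?D t (z \<circ> transpose t s) n"
          by simp
        also have "?D t (z \<circ> transpose t s) n = ?D t z n"
          by (rule prod.cong) (use s in \<open>auto simp: transpose_def\<close>)
        finally show ?thesis .
      qed
      have zD2: "?D t z (Suc n) = ?D t z n * (\<Prod>r\<in>{t<..k}. z r - ?y)"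
        by (simp add: prod.distrib)
      have row: "(\<Prod>a=1..t. row_factor I x y (Suc n) a) =
        (\<Prod>a=1..t'. row_factor I x y n a) * (\<Prod>a=1..t'. x a - ?y + 1) * (\<Prod>i=1..n. z s - y i)"
      proof -
        have "(\<Prod>a=1..t'. row_factor I x y (Suc n) a) = (\<Prod>a=1..t'. row_factor I x y n a * (x a - ?y + 1))"
          by (rule prod.cong) (use lt in \<open>auto simp: row_factor_Suc less_Suc_eq_le\<close>)
        moreover have "row_factor I x y (Suc n) t = (\<Prod>i=1..n. z s - y i)"
          using t'(2) by (simp add: row_factor_last x_def \<pi>t)
        ultimately show ?thesis unfolding s1(1) using s1(2) by (simp add: prod.distrib mult_ac)
      qed
      have pair: "layers.pair_factor t x = layers.pair_factor t' x *
          (\<Prod>a=1..t'. (z s - x a + 1) / (z s - x a))"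
      proof -
        have "(v - z s - 1) / (v - z s) = (z s - v + 1) / (z s - v)" for v
        proof -
          have "v - z s - 1 = - (z s - v + 1)" "v - z s = - (z s - v)" by simp_all
          then show ?thesis by (simp only: minus_divide_divide)
        qed
        moreover have "x (Suc t') = z s" using \<pi>t t' by (simp add: x_def)
        ultimately show ?thesis unfolding t'(1) pair_factor_Suc by simp
      qed
      have re: "(\<Prod>a=1..t'. x a - ?y + 1) * (\<Prod>a=1..t'. (z s - x a + 1) / (z s - x a)) =
        (\<Prod>i\<in>{1..t} - {s}. (z i - ?y + 1) * ((z s - z i + 1) / (z s - z i)))"
        unfolding prod.distrib[symmetric]
        using prod.reindex_bij_betw[OF bij, of "\<lambda>i. (z i - ?y + 1) * ((z s - z i + 1) / (z s - z i))"]
        by (simp add: x_def)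
      have x: "z \<circ> (transpose t s \<circ> q) = x" "z \<circ> transpose t s \<circ> q = x"
        by (simp_all add: x_def \<pi>_def o_assoc)
      show ?thesis
        unfolding x c zD zD2 row pair re[symmetric] by (simp only: mult_ac)
    qed
    have "layer_op z k vac y u (Suc n) (f z) w =
      (\<Sum>r\<in>{1..t}. (\<Prod>i\<in>{1..<r}. z i - ?y) * (\<Prod>i\<in>{r<..t}. z i - ?y + 1) * \<Phi> r z) *
      (\<Prod>r\<in>{t<..k}. z r - ?y)"
      unfolding layer_op.simps e_def[symmetric] \<Phi>_def
      by (rule column_op_emit[OF Suc.prems(1,4,5) e])
    also have "(\<Sum>r\<in>{1..t}. (\<Prod>i\<in>{1..<r}. z i - ?y) * (\<Prod>i\<in>{r<..t}. z i - ?y + 1) * \<Phi> r z) =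
      (\<Sum>s\<in>{1..t}. (\<Prod>i\<in>{1..t} - {s}. (z i - ?y + 1) * ((z s - z i + 1) / (z s - z i))) *
       \<Phi> t (z \<circ> transpose t s))"
      by (rule one_particle[OF phi_ex phi_sym Suc.prems(6,1)])
    also have "\<dots> * (\<Prod>r\<in>{t<..k}. z r - ?y) = (\<Sum>s\<in>{1..t}. \<Sum>q | q permutes {1..t'}.
       (\<Prod>i\<in>{1..t} - {s}. (z i - ?y + 1) * ((z s - z i + 1) / (z s - z i))) *
       (?G t' (w(t := e)) (z \<circ> transpose t s) n q * ?D t' (z \<circ> transpose t s) n) * (\<Prod>r\<in>{t<..k}. z r - ?y))"
      unfolding sum_distrib_right
    proof (rule sum.cong[OF refl])
      fix s assume s: "s \<in> {1..t}"
      have "transpose t s permutes {1..k}"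
        by (rule permutes_swap_id) (use s Suc.prems in auto)
      note IH' = IH[OF inj_on_comp_permutes[OF Suc.prems(6) this]]
      show "(\<Prod>i\<in>{1..t} - {s}. (z i - ?y + 1) * ((z s - z i + 1) / (z s - z i))) *
         \<Phi> t (z \<circ> transpose t s) * (\<Prod>r\<in>{t<..k}. z r - ?y) = (\<Sum>q | q permutes {1..t'}.
       (\<Prod>i\<in>{1..t} - {s}. (z i - ?y + 1) * ((z s - z i + 1) / (z s - z i))) *
       (?G t' (w(t := e)) (z \<circ> transpose t s) n q * ?D t' (z \<circ> transpose t s) n) * (\<Prod>r\<in>{t<..k}. z r - ?y))"
        unfolding IH' by (simp only: sum_distrib_left sum_distrib_right)
    qed
    also have "\<dots> = (\<Sum>s\<in>{1..t}. \<Sum>q | q permutes {1..t'}. ?G t w z (Suc n) (transpose t s \<circ> q) * ?D t z (Suc n))"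
      by (intro sum.cong refl) (simp only: G mem_Collect_eq)
    also have "\<dots> = (\<Sum>\<tau> | \<tau> permutes {1..t}. ?G t w z (Suc n) \<tau> * ?D t z (Suc n))"
      unfolding s1(1) by (rule sum_over_permutations_insert[symmetric]) (use s1(2) in auto)
    finally show ?thesis unfolding sum_distrib_right .
  qed
qed

section \<open>The sum over edge colourings as a composition of vertex operators\<close>

text \<open>The colours of the edges in \<open>D\<close> are summed out; those of the other edges are given by \<open>A\<close>.\<close>

definition isum :: "nat set \<Rightarrow> 'e set \<Rightarrow> (('e \<Rightarrow> nat) \<Rightarrow> 'a::field) \<Rightarrow> ('e \<Rightarrow> nat) \<Rightarrow> 'a" where
  "isum C D H A = (\<Sum>f\<in>D \<rightarrow>\<^sub>E C. H (override_on A f D))"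

lemma isum_empty [simp]: "isum C {} H A = H A"
  by (simp add: isum_def)

lemma isum_insert:
  assumes "e \<notin> D"
  shows "isum C (insert e D) H A = (\<Sum>c\<in>C. isum C D H (A(e := c)))"
proof -
  have "override_on A (g(e := c)) (insert e D) = override_on (A(e := c)) g D" for g c
    using assms by (auto simp: override_on_def fun_eq_iff)
  then show ?thesis
    unfolding isum_def PiE_insert_eq sum.cartesian_product
    by (subst sum.reindex[OF inj_combinator[OF assms]]) (auto intro!: sum.cong)
qed

lemma isum_union:
  assumes "finite E" "D \<inter> E = {}"
  shows "isum C (D \<union> E) H A = isum C E (isum C D H) A"
  using assms
proof (induction E arbitrary: A)
  case (insert e E)
  then show ?case by (simp add: isum_insert)
qed simp

lemma isum_mult_right:
  assumes "\<And>f. X (override_on A f D) = X A"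
  shows "isum C D (\<lambda>A. H A * X A) A = isum C D H A * X A"
  by (simp add: isum_def assms sum_distrib_right)

lemma isum_cong:
  assumes "\<And>f. f \<in> D \<rightarrow>\<^sub>E C \<Longrightarrow> H (override_on A f D) = H' (override_on A f D)"
  shows "isum C D H A = isum C D H' A"
  unfolding isum_def by (rule sum.cong) (use assms in auto)

text \<open>Since \<open>X\<close> does not read the edges of \<open>E\<close>, exactly one
  assignment on \<open>E\<close> survives; its values must lie in \<open>C\<close> for it to occur
  in the sum.\<close>

lemma isum_pin:
  assumes "finite C" "finite E" "\<And>f. X (override_on A f E) = X A" "\<And>e. e \<in> E \<Longrightarrow> X A e \<in> C"
  shows "isum C E (\<lambda>A. H A * of_bool (\<forall>e\<in>E. A e = X A e)) A = H (override_on A (X A) E)"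
proof -
  let ?f = "restrict (X A) E"
  have f: "?f \<in> E \<rightarrow>\<^sub>E C" using assms(4) by auto
  have eq: "(\<forall>e\<in>E. override_on A f E e = X (override_on A f E) e) \<longleftrightarrow> f = ?f" if "f \<in> E \<rightarrow>\<^sub>E C" for f
    using that assms(3) by (auto simp: fun_eq_iff PiE_def extensional_def)
  have "isum C E (\<lambda>A. H A * of_bool (\<forall>e\<in>E. A e = X A e)) A =
    (\<Sum>f\<in>E \<rightarrow>\<^sub>E C. if f = ?f then H (override_on A f E) else 0)"
    unfolding isum_def by (rule sum.cong[OF refl]) (simp only: eq, simp)
  also have "\<dots> = H (override_on A ?f E)"
    using f assms(1,2) by (subst sum.delta) (auto intro!: finite_PiE)
  also have "override_on A ?f E = override_on A (X A) E"
    by (auto simp: override_on_def)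
  finally show ?thesis .
qed

section \<open>From one vertex to a whole layer\<close>

text \<open>The R-matrix is \<open>x - y\<close> times the identity plus the flip; both terms
  contribute when all four colours agree, which gives \<open>x - y + 1\<close>.\<close>

lemma vertex_weight_eq:
  "vertex_weight x y a b c d = (x - y) * of_bool (a = c \<and> b = d) + of_bool (a = d \<and> b = c)"
  by (auto simp: vertex_weight_def)

lemma sum_vertex_weight:
  assumes "finite C" "c \<in> C" "d \<in> C"
  shows "(\<Sum>a\<in>C. \<Sum>b\<in>C. G a b * vertex_weight x y a b c d) = (x - y) * G c d + G d c"
proof -
  have *: "(\<Sum>a\<in>C. \<Sum>b\<in>C. G a b * of_bool (a = c \<and> b = d)) = G c d"
    if "c \<in> C" "d \<in> C" for c d
  proof -
    have "(\<Sum>a\<in>C. \<Sum>b\<in>C. G a b * of_bool (a = c \<and> b = d)) =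
      (\<Sum>a\<in>C. if a = c then \<Sum>b\<in>C. if b = d then G a b else 0 else 0)"
      by (intro sum.cong refl) (auto intro!: sum.cong)
    then show ?thesis using that assms(1) by (simp add: sum.delta)
  qed
  have "(\<Sum>a\<in>C. \<Sum>b\<in>C. G a b * vertex_weight x y a b c d) =
    (x - y) * (\<Sum>a\<in>C. \<Sum>b\<in>C. G a b * of_bool (a = c \<and> b = d)) +
    (\<Sum>a\<in>C. \<Sum>b\<in>C. G a b * of_bool (a = d \<and> b = c))"
    unfolding sum_distrib_left sum.distrib[symmetric]
    by (intro sum.cong refl) (simp only: vertex_weight_eq, simp add: algebra_simps)
  then show ?thesis using * assms by simp
qed

text \<open>\<open>Inl\<close> for horizontal and \<open>Inr\<close> for vertical edges.\<close>

type_synonym edge = "(nat \<times> nat \<times> nat) + (nat \<times> nat \<times> nat)"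

abbreviation he :: "nat \<Rightarrow> nat \<Rightarrow> nat \<Rightarrow> edge" where "he p r s \<equiv> Inl (p, r, s)"
abbreviation ve :: "nat \<Rightarrow> nat \<Rightarrow> nat \<Rightarrow> edge" where "ve p r s \<equiv> Inr (p, r, s)"

abbreviation edge_weight ::
  "nat \<Rightarrow> (nat \<Rightarrow> 'a::field) \<Rightarrow> (nat \<Rightarrow> 'a) \<Rightarrow> (edge \<Rightarrow> nat) \<Rightarrow> nat \<Rightarrow> nat \<Rightarrow> 'a" where
  "edge_weight p x y A s r \<equiv> vertex_weight (x r) (y s)
     (A (he p r (s - 1))) (A (ve p r s)) (A (he p r s)) (A (ve p (r - 1) s))"

text \<open>The fixed value 0 outside the rows makes equal row colourings equal as
  functions.\<close>

definition row_cols :: "nat \<Rightarrow> nat \<Rightarrow> (edge \<Rightarrow> nat) \<Rightarrow> nat \<Rightarrow> nat \<Rightarrow> nat" where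
  "row_cols k p A s = (\<lambda>r. if r \<in> {1..k} then A (he p r s) else 0)"

text \<open>The left edges of the new column and its vertical edges below the top are summed; the
  top edges stay free, hence the first argument of \<open>F\<close>. By the conditions on
  \<open>D\<close> nothing further right has been summed yet, so the new weights are constants for
  the earlier sum.\<close>

lemma isum_column:
  fixes F :: "(nat \<Rightarrow> nat) \<Rightarrow> (nat \<Rightarrow> nat) \<Rightarrow> 'a::field"
  assumes C: "finite C"
    and base: "\<And>A. range A \<subseteq> C \<Longrightarrow> isum C D \<Omega> A = F (\<lambda>s. A (ve p 0 s)) (row_cols k p A n)"
    and D: "\<And>r s. n \<le> s \<Longrightarrow> he p r s \<notin> D" "\<And>r s. n < s \<Longrightarrow> ve p r s \<notin> D"
    and A: "range A \<subseteq> C"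
  shows "isum C (D \<union> ((\<lambda>r. he p r n) ` {1..k} \<union> (\<lambda>r. ve p r (Suc n)) ` {1..k}))
     (\<lambda>A. \<Omega> A * (of_bool (A (ve p k (Suc n)) = vac) * (\<Prod>r=1..k. edge_weight p x y A (Suc n) r))) A =
     column_op x k vac (y (Suc n)) (F (\<lambda>s. A (ve p 0 s))) (row_cols k p A (Suc n)) (A (ve p 0 (Suc n)))"
proof -
  \<comment> \<open>The row state once the vertices in rows \<open>Suc j\<close> to \<open>k\<close>
    are summed: those rows show their right edges, the rows up to \<open>j\<close> still their left
    edges. The induction runs from \<open>j = k\<close> to \<open>j = 0\<close>.\<close>
  define mix where "mix j A = (\<lambda>r. if r \<in> {1..k} then if r \<le> j then A (he p r n) else A (he p r (Suc n)) else 0)"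
    for j and A :: "edge \<Rightarrow> nat"
  let ?y = "y (Suc n)"
  let ?D = "\<lambda>j. D \<union> ((\<lambda>r. he p r n) ` {Suc j..k} \<union> (\<lambda>r. ve p r (Suc n)) ` {Suc j..k})"
  let ?\<Omega> = "\<lambda>j A. \<Omega> A * (of_bool (A (ve p k (Suc n)) = vac) * (\<Prod>r=Suc j..k. edge_weight p x y A (Suc n) r))"
  let ?g = "\<lambda>A w b. F (\<lambda>s. A (ve p 0 s)) w * of_bool (b = vac)"
  have "isum C (?D j) (?\<Omega> j) A = 
     foldr (\<lambda>r. vtx (x r - ?y) r) [Suc j..<Suc k] (?g A) (mix j A) (A (ve p j (Suc n)))"
    if "j \<le> k" "range A \<subseteq> C" for j and A :: "edge \<Rightarrow> nat"
    using that
  proof (induction arbitrary: A rule: inc_induct)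
    case base
    have "mix k A = row_cols k p A n" by (auto simp: mix_def row_cols_def)
    moreover have "isum C D (\<lambda>A. \<Omega> A * of_bool (A (ve p k (Suc n)) = vac)) A =
      isum C D \<Omega> A * of_bool (A (ve p k (Suc n)) = vac)"
      by (rule isum_mult_right) (use D(2) in \<open>auto simp: override_on_def\<close>)
    ultimately show ?case using assms(2)[OF base] by simp
  next
    case (step j)
    let ?r = "Suc j"
    let ?a = "he p ?r n" and ?b = "ve p ?r (Suc n)"
    let ?c = "A (he p ?r (Suc n))" and ?d = "A (ve p j (Suc n))"
    let ?G = "\<lambda>\<alpha> \<beta>. foldr (\<lambda>r. vtx (x r - ?y) r) [Suc ?r..<Suc k] (?g A) ((mix j A)(?r := \<alpha>)) \<beta>"
    have ins: "{?r..k} = insert ?r {Suc ?r..k}" using step by auto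
    have D': "?D j = insert ?a (insert ?b (?D ?r))"
      unfolding ins by auto
    have nin: "?b \<notin> ?D ?r" "?a \<notin> insert ?b (?D ?r)" using D by auto
    have \<Omega>: "?\<Omega> j = (\<lambda>A. ?\<Omega> ?r A * edge_weight p x y A (Suc n) ?r)"
      unfolding ins by (simp add: fun_eq_iff mult_ac)
    have inner: "isum C (?D ?r) (?\<Omega> j) (A(?a := \<alpha>, ?b := \<beta>)) =
      ?G \<alpha> \<beta> * vertex_weight (x ?r) ?y \<alpha> \<beta> ?c ?d" if "\<alpha> \<in> C" "\<beta> \<in> C" for \<alpha> \<beta>
    proof -
      let ?A = "A(?a := \<alpha>, ?b := \<beta>)"
      have r: "range ?A \<subseteq> C" using that step.prems by auto
      have "mix ?r ?A = (mix j A)(?r := \<alpha>)"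
        using step.hyps by (auto simp: mix_def fun_eq_iff)
      moreover have "?g ?A = ?g A" by (simp add: fun_eq_iff)
      ultimately have IH: "isum C (?D ?r) (?\<Omega> ?r) ?A = ?G \<alpha> \<beta>"
        using step.IH[OF r] by (simp only: fun_upd_same)
      have "isum C (?D ?r) (?\<Omega> j) ?A = isum C (?D ?r) (?\<Omega> ?r) ?A * edge_weight p x y ?A (Suc n) ?r"
        unfolding \<Omega> by (rule isum_mult_right) (use D in \<open>auto simp: override_on_def\<close>)
      then show ?thesis unfolding IH by simp
    qed
    have "isum C (?D j) (?\<Omega> j) A = (\<Sum>\<alpha>\<in>C. \<Sum>\<beta>\<in>C. isum C (?D ?r) (?\<Omega> j) (A(?a := \<alpha>, ?b := \<beta>)))"
      unfolding D' isum_insert[OF nin(2)] isum_insert[OF nin(1)] ..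
    also have "\<dots> = (\<Sum>\<alpha>\<in>C. \<Sum>\<beta>\<in>C. ?G \<alpha> \<beta> * vertex_weight (x ?r) ?y \<alpha> \<beta> ?c ?d)"
      by (intro sum.cong refl inner)
    also have "\<dots> = (x ?r - ?y) * ?G ?c ?d + ?G ?d ?c"
      by (rule sum_vertex_weight) (use C step.prems in auto)
    also have "\<dots> = foldr (\<lambda>r. vtx (x r - ?y) r) [?r..<Suc k] (?g A) (mix j A) ?d"
    proof -
      have "mix j A ?r = ?c" using step.hyps by (simp add: mix_def)
      moreover have "(mix j A)(?r := ?c) = mix j A" using calculation by auto
      moreover have "[?r..<Suc k] = ?r # [Suc ?r..<Suc k]" using step.hyps by (intro upt_conv_Cons) auto
      ultimately show ?thesis by (simp add: vtx_def[of _ _ "foldr _ _ _"] del: upt_Suc)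
    qed
    finally show ?case .
  qed
  moreover have "mix 0 A = row_cols k p A (Suc n)" by (auto simp: mix_def row_cols_def)
  ultimately show ?thesis
    using A by (simp add: column_op_def del: upt_Suc)
qed

lemma isum_layer:
  fixes F :: "(nat \<Rightarrow> nat) \<Rightarrow> 'a::field"
  assumes C: "finite C"
    and base: "\<And>A. range A \<subseteq> C \<Longrightarrow> isum C D \<Omega> A = F (row_cols k p A 0)"
    and D: "\<And>r s. he p r s \<notin> D" "\<And>r s. ve p r s \<notin> D"
    and A: "range A \<subseteq> C"
  shows "isum C (D \<union> ((\<lambda>(r, s). he p r s) ` ({1..k} \<times> {0..<n}) \<union> (\<lambda>(r, s). ve p r s) ` ({1..k} \<times> {1..n})))
     (\<lambda>A. \<Omega> A * (\<Prod>s=1..n. of_bool (A (ve p k s) = vac) * (\<Prod>r=1..k. edge_weight p x y A s r))) A =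
     layer_op x k vac y (\<lambda>s. A (ve p 0 s)) n F (row_cols k p A n)"
  using A
proof (induction n arbitrary: A)
  case 0
  then show ?case using base by simp
next
  case (Suc n)
  let ?D = "\<lambda>n. D \<union> ((\<lambda>(r, s). he p r s) ` ({1..k} \<times> {0..<n}) \<union> (\<lambda>(r, s). ve p r s) ` ({1..k} \<times> {1..n}))"
  have D': "?D (Suc n) = ?D n \<union> ((\<lambda>r. he p r n) ` {1..k} \<union> (\<lambda>r. ve p r (Suc n)) ` {1..k})"
    by (auto simp: less_Suc_eq le_Suc_eq image_iff)
  have P: "(\<lambda>A. \<Omega> A * (\<Prod>s=1..Suc n. of_bool (A (ve p k s) = vac) * (\<Prod>r=1..k. edge_weight p x y A s r))) =
    (\<lambda>A. (\<Omega> A * (\<Prod>s=1..n. of_bool (A (ve p k s) = vac) * (\<Prod>r=1..k. edge_weight p x y A s r))) *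
      (of_bool (A (ve p k (Suc n)) = vac) * (\<Prod>r=1..k. edge_weight p x y A (Suc n) r)))"
    by (simp add: fun_eq_iff mult_ac)
  show ?case unfolding D' P layer_op.simps
    by (rule isum_column[where F = "\<lambda>u. layer_op x k vac y u n F", OF C Suc.IH _ _ Suc.prems]) (use D in auto)
qed

section \<open>Stacking the layers\<close>

context layers
begin

text \<open>\<open>m\<close> concatenates lists of any type; here it is applied to colours, and
  \<open>w\<close>, the left edges of layer \<open>p + 1\<close>, fills the middle block.\<close>

definition top_cols :: "(nat \<Rightarrow> nat) \<Rightarrow> nat \<Rightarrow> (nat \<Rightarrow> nat) \<Rightarrow> nat \<Rightarrow> nat" where
  "top_cols col p w s =
     (if p < M then m (\<lambda>q i. col (coordI q i)) (\<lambda>q i. col (coordII q i)) p w s else col (coordM s))"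

definition col_vars ::
  "(nat \<Rightarrow> nat \<Rightarrow> 'a) \<Rightarrow> (nat \<Rightarrow> nat \<Rightarrow> 'a) \<Rightarrow> (nat \<Rightarrow> 'a) \<Rightarrow> nat \<Rightarrow> (nat \<Rightarrow> 'a) \<Rightarrow> nat \<Rightarrow> 'a" where
  "col_vars yI yII yM p z s = (if p < M then m yI yII p z s else yM s)"

lemma column_var_eq: "column_var x yI yII yM p = col_vars yI yII yM p (x (Suc p))"
  by (simp add: column_var_def col_vars_def fun_eq_iff)

abbreviation vac_row :: "nat \<Rightarrow> nat \<Rightarrow> nat" where
  "vac_row p \<equiv> (\<lambda>r. if r \<in> {1..k p} then Suc p else 0)"

text \<open>
  The partition function of the layers \<open>1, \<dots>, p\<close>, as a function of the left edges of layer \<open>p + 1\<close>: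
  \<open>z\<close> plays the role of \<open>x (p + 1)\<close> and \<open>w\<close> lists their colours. For \<open>p = M\<close> neither matters.
\<close>

primrec lower_psi ::
  "(nat \<Rightarrow> nat \<Rightarrow> 'a::field) \<Rightarrow> (nat \<Rightarrow> nat \<Rightarrow> 'a) \<Rightarrow> (nat \<Rightarrow> nat \<Rightarrow> 'a) \<Rightarrow> (nat \<Rightarrow> 'a) \<Rightarrow>
   (nat \<Rightarrow> nat) \<Rightarrow> nat \<Rightarrow> (nat \<Rightarrow> 'a) \<Rightarrow> (nat \<Rightarrow> nat) \<Rightarrow> 'a" where
  "lower_psi x yI yII yM col 0 = (\<lambda>z w. of_bool (\<forall>r\<in>{1..k 1}. w r = 1))"
| "lower_psi x yI yII yM col (Suc p) = (\<lambda>z w.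
     layer_op (x (Suc p)) (k (Suc p)) (Suc (Suc p)) (col_vars yI yII yM (Suc p) z)
       (top_cols col (Suc p) w) (N (Suc p)) (lower_psi x yI yII yM col p (x (Suc p))) (vac_row (Suc p)))"

definition lower_edges :: "nat \<Rightarrow> edge set" where
  "lower_edges p = (\<lambda>(q, r, s). he q r s) ` (SIGMA q:{1..p}. {1..k q} \<times> {0..N q}) \<union>
     (\<lambda>(q, r, s). ve q r s) ` (SIGMA q:{1..p}. {0..k q} \<times> {1..N q})"

text \<open>These edges are pinned after the layer has been evaluated. The left edges are summed
  together with the layer, and the bottom condition is a factor of
  \<open>layer_weight\<close>.\<close>

definition outer_edges :: "nat \<Rightarrow> edge set" where
  "outer_edges p = (\<lambda>r. he p r (N p)) ` {1..k p} \<union> (\<lambda>s. ve p 0 s) ` {1..N p}"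

definition outer_cols :: "(nat \<Rightarrow> nat) \<Rightarrow> nat \<Rightarrow> (edge \<Rightarrow> nat) \<Rightarrow> edge \<Rightarrow> nat" where
  "outer_cols col p A e = (case e of Inl _ \<Rightarrow> Suc p
     | Inr (_, _, s) \<Rightarrow> top_cols col p (row_cols (k (Suc p)) (Suc p) A 0) s)"

definition layer_weight ::
  "(nat \<Rightarrow> nat \<Rightarrow> 'a::field) \<Rightarrow> (nat \<Rightarrow> nat \<Rightarrow> 'a) \<Rightarrow> (nat \<Rightarrow> nat \<Rightarrow> 'a) \<Rightarrow> (nat \<Rightarrow> 'a) \<Rightarrow>
   (nat \<Rightarrow> nat) \<Rightarrow> nat \<Rightarrow> (edge \<Rightarrow> nat) \<Rightarrow> 'a" where
  "layer_weight x yI yII yM col p A =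
     (\<Prod>s=1..N p. of_bool (A (ve p (k p) s) = Suc p) *
        (\<Prod>r=1..k p. edge_weight p (x p) (column_var x yI yII yM p) A s r)) *
     of_bool (\<forall>e\<in>outer_edges p. A e = outer_cols col p A e)"

definition lower_weight ::
  "(nat \<Rightarrow> nat \<Rightarrow> 'a::field) \<Rightarrow> (nat \<Rightarrow> nat \<Rightarrow> 'a) \<Rightarrow> (nat \<Rightarrow> nat \<Rightarrow> 'a) \<Rightarrow> (nat \<Rightarrow> 'a) \<Rightarrow>
   (nat \<Rightarrow> nat) \<Rightarrow> nat \<Rightarrow> (edge \<Rightarrow> nat) \<Rightarrow> 'a" where
  "lower_weight x yI yII yM col p A =
     of_bool (\<forall>r\<in>{1..k 1}. A (he 1 r 0) = 1) * (\<Prod>q=1..p. layer_weight x yI yII yM col q A)"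

lemma top_cols_in:
  assumes "admissible col" "p \<in> {1..M}" "{1..Suc p} \<subseteq> C" "\<And>r. r \<in> {1..k (Suc p)} \<Longrightarrow> w r \<in> C"
    "s \<in> {1..N p}"
  shows "top_cols col p w s \<in> C"
proof -
  have c: "col c \<in> C" if "c \<in> layer_coords p" for c
    using that assms(1,2,3) unfolding admissible_def by fastforce
  show ?thesis
  proof (cases "p < M")
    case True
    then have s: "s \<le> LI p + k (Suc p) + LII p" "1 \<le> s" using assms(5) by (auto simp: N_def)
    consider "s \<le> LI p" | "s - LI p \<in> {1..k (Suc p)}" "\<not> s \<le> LI p" "s \<le> LI p + k (Suc p)"
      | "s - LI p - k (Suc p) \<in> {1..LII p}" "\<not> s \<le> LI p + k (Suc p)"
      using s by fastforce
    then show ?thesis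
    proof cases
      case 1
      then have "coordI p s \<in> layer_coords p" using s True by (simp add: layer_coords_def)
      then show ?thesis using 1 True c by (simp add: top_cols_def m_def)
    next
      case 2
      then show ?thesis using True assms(4) by (simp add: top_cols_def m_def)
    next
      case 3
      then have "coordII p (s - LI p - k (Suc p)) \<in> layer_coords p"
        using True by (simp only: layer_coords_def) auto
      then show ?thesis using 3 True c by (simp add: top_cols_def m_def)
    qed
  next
    case False
    then have "coordM s \<in> layer_coords p" using assms(5) by (auto simp: layer_coords_def N_def)
    then show ?thesis using False c by (simp add: top_cols_def)
  qed
qed

lemma outer_cols_cong:
  assumes "row_cols (k (Suc p)) (Suc p) A 0 = row_cols (k (Suc p)) (Suc p) B 0"
  shows "outer_cols col p A = outer_cols col p B"
  unfolding outer_cols_def assms ..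

lemma outer_iff:
  "(\<forall>e\<in>outer_edges p. A e = outer_cols col p A e) \<longleftrightarrow> (\<forall>r\<in>{1..k p}. A (he p r (N p)) = Suc p) \<and>
     (\<forall>s\<in>{1..N p}. A (ve p 0 s) = top_cols col p (row_cols (k (Suc p)) (Suc p) A 0) s)"
  by (simp add: outer_edges_def outer_cols_def ball_Un)

text \<open>Induction over the layers: the inner edges are summed by \<open>isum_layer\<close>,
  starting from the function of the layers below, and then the right and top edges are pinned. The
  left edges of the next layer stay free.\<close>

lemma isum_lower:
  fixes x yI yII :: "nat \<Rightarrow> nat \<Rightarrow> 'a::field" and yM :: "nat \<Rightarrow> 'a"
  assumes adm: "admissible col" and p: "p \<le> M" and A: "range A \<subseteq> {1..M + 1}"
  shows "isum {1..M + 1} (lower_edges p) (lower_weight x yI yII yM col p) A =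
    lower_psi x yI yII yM col p (x (Suc p)) (row_cols (k (Suc p)) (Suc p) A 0)"
  using p A
proof (induction p arbitrary: A)
  case 0
  then show ?case by (simp add: lower_edges_def lower_weight_def row_cols_def)
next
  case (Suc p)
  let ?C = "{1..M + 1}" and ?q = "Suc p"
  let ?K = "{1..k ?q}" and ?E = "outer_edges ?q"
  let ?D = "lower_edges p \<union> ((\<lambda>(r, s). he ?q r s) ` (?K \<times> {0..<N ?q}) \<union> (\<lambda>(r, s). ve ?q r s) ` (?K \<times> {1..N ?q}))"
  let ?\<Omega> = "\<lambda>A. lower_weight x yI yII yM col p A * (\<Prod>s=1..N ?q. of_bool (A (ve ?q (k ?q) s) = Suc ?q) *
        (\<Prod>r=1..k ?q. edge_weight ?q (x ?q) (column_var x yI yII yM ?q) A s r))"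
  let ?ind = "\<lambda>A. of_bool (\<forall>e\<in>?E. A e = outer_cols col ?q A e) :: 'a"
  let ?L = "\<lambda>A. layer_op (x ?q) (k ?q) (Suc ?q) (column_var x yI yII yM ?q) (\<lambda>s. A (ve ?q 0 s)) (N ?q)
    (lower_psi x yI yII yM col p (x ?q)) (row_cols (k ?q) ?q A (N ?q))"
  have fin: "finite ?E" by (simp add: outer_edges_def)
  have ivl: "{0..N ?q} = insert (N ?q) {0..<N ?q}" "{0..k ?q} = insert 0 ?K" by auto
  have set: "lower_edges ?q = ?D \<union> ?E"
  proof -
    have "{1..?q} = insert ?q {1..p}" by auto
    then show ?thesis unfolding lower_edges_def outer_edges_def by (auto simp: ivl image_iff)
  qed
  have disj: "?D \<inter> ?E = {}"
    by (auto simp: lower_edges_def outer_edges_def)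
  have weight: "lower_weight x yI yII yM col ?q = (\<lambda>A. ?\<Omega> A * ?ind A)"
    by (simp add: lower_weight_def layer_weight_def fun_eq_iff mult_ac)
  have inner: "isum ?C ?D (\<lambda>A. ?\<Omega> A * ?ind A) A = ?L A * ?ind A" if "range A \<subseteq> ?C" for A
  proof -
    \<comment> \<open>The indicator reads only the outer edges and the left edges of the next layer,
      none of which lies in \<open>?D\<close>.\<close>
    have "isum ?C ?D (\<lambda>A. ?\<Omega> A * ?ind A) A = isum ?C ?D ?\<Omega> A * ?ind A"
    proof (rule isum_mult_right)
      fix f
      have "override_on A f ?D e = A e" if "e \<in> ?E" for e
        using that disj by (intro override_on_apply_notin) blast
      moreover have "outer_cols col ?q (override_on A f ?D) = outer_cols col ?q A"
      proof (rule outer_cols_cong)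
        have "he (Suc ?q) r 0 \<notin> ?D" for r by (auto simp: lower_edges_def)
        then have "override_on A f ?D (he (Suc ?q) r 0) = A (he (Suc ?q) r 0)" for r
          by (rule override_on_apply_notin)
        then show "row_cols (k (Suc ?q)) (Suc ?q) (override_on A f ?D) 0 = row_cols (k (Suc ?q)) (Suc ?q) A 0"
          by (simp only: row_cols_def)
      qed
      ultimately show "?ind (override_on A f ?D) = ?ind A"
        by (simp only: cong: ball_cong)
    qed
    also have "isum ?C ?D ?\<Omega> A = ?L A"
      by (rule isum_layer[OF _ _ _ _ that]) (use Suc in \<open>auto simp: lower_edges_def\<close>)
    finally show ?thesis .
  qed
  have "isum ?C (lower_edges ?q) (lower_weight x yI yII yM col ?q) A =
    isum ?C ?E (isum ?C ?D (\<lambda>A. ?\<Omega> A * ?ind A)) A"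
    unfolding set weight by (rule isum_union[OF fin disj])
  also have "\<dots> = isum ?C ?E (\<lambda>A. ?L A * ?ind A) A"
  proof (rule isum_cong)
    fix f :: "edge \<Rightarrow> nat" assume "f \<in> ?E \<rightarrow>\<^sub>E ?C"
    then have "range (override_on A f ?E) \<subseteq> ?C"
      using Suc.prems(2) by (force simp: override_on_def PiE_iff)
    then show "isum ?C ?D (\<lambda>A. ?\<Omega> A * ?ind A) (override_on A f ?E) = ?L (override_on A f ?E) * ?ind (override_on A f ?E)"
      by (rule inner)
  qed
  also have "\<dots> = ?L (override_on A (outer_cols col ?q A) ?E)"
  proof (rule isum_pin[OF _ fin])
    fix f
    have "row_cols (k (Suc ?q)) (Suc ?q) (override_on A f ?E) 0 = row_cols (k (Suc ?q)) (Suc ?q) A 0"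
    proof -
      have "he (Suc ?q) r 0 \<notin> ?E" for r by (auto simp: outer_edges_def)
      then have "override_on A f ?E (he (Suc ?q) r 0) = A (he (Suc ?q) r 0)" for r
        by (rule override_on_apply_notin)
      then show ?thesis by (simp only: row_cols_def)
    qed
    then show "outer_cols col ?q (override_on A f ?E) = outer_cols col ?q A"
      by (rule outer_cols_cong)
  next
    fix e assume e: "e \<in> ?E"
    have w: "row_cols (k (Suc ?q)) (Suc ?q) A 0 r \<in> ?C" if "r \<in> {1..k (Suc ?q)}" for r
    proof -
      have "A (he (Suc ?q) r 0) \<in> ?C" using Suc.prems(2) by (rule subsetD) (rule rangeI)
      then show ?thesis using that by (simp add: row_cols_def)
    qed
    have "top_cols col ?q (row_cols (k (Suc ?q)) (Suc ?q) A 0) s \<in> ?C" if "s \<in> {1..N ?q}" for s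
      by (rule top_cols_in[OF adm _ _ w that]) (use Suc.prems in auto)
    then show "outer_cols col ?q A e \<in> ?C"
      using e Suc.prems(1) by (auto simp: outer_edges_def outer_cols_def)
  qed simp
  also have "\<dots> = lower_psi x yI yII yM col ?q (x (Suc ?q)) (row_cols (k (Suc ?q)) (Suc ?q) A 0)"
  proof -
    let ?B = "override_on A (outer_cols col ?q A) ?E"
    have "row_cols (k ?q) ?q ?B (N ?q) = vac_row ?q"
      by (auto simp: row_cols_def outer_edges_def outer_cols_def)
    moreover have "layer_op (x ?q) (k ?q) (Suc ?q) y (\<lambda>s. ?B (ve ?q 0 s)) (N ?q) F =
      layer_op (x ?q) (k ?q) (Suc ?q) y (top_cols col ?q (row_cols (k (Suc ?q)) (Suc ?q) A 0)) (N ?q) F" for y F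
      by (rule layer_op_cong) (auto simp: outer_edges_def outer_cols_def)
    ultimately show ?thesis by (simp add: column_var_eq)
  qed
  finally show ?case .
qed

section \<open>Comparison with the defining sum over edge colourings\<close>

text \<open>Groups the conditions by layer, as in \<open>layer_weight\<close>: the gluing of layers
  and the prescribed coordinate colours together form one condition on the top edges.\<close>

lemma boundary_iff:
  "boundary col h v \<longleftrightarrow> (\<forall>r\<in>{1..k 1}. h (1, r, 0) = 1) \<and>
     (\<forall>p\<in>{1..M}. (\<forall>s\<in>{1..N p}. v (p, k p, s) = Suc p) \<and> (\<forall>r\<in>{1..k p}. h (p, r, N p) = Suc p) \<and>
        (\<forall>s\<in>{1..N p}. v (p, 0, s) = top_cols col p (\<lambda>r. h (Suc p, r, 0)) s))"
  (is "_ \<longleftrightarrow> ?R")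
  if "M \<ge> 1"
proof -
  have *: "(\<forall>s\<in>{1..N p}. v (p, 0, s) = top_cols col p (\<lambda>r. h (Suc p, r, 0)) s) \<longleftrightarrow>
    (\<forall>r\<in>{1..k (p + 1)}. h (p + 1, r, 0) = v (p, 0, LI p + r)) \<and>
    (\<forall>s\<in>{1..LI p}. v (p, 0, s) = col (coordI p s)) \<and>
    (\<forall>s\<in>{1..LII p}. v (p, 0, LI p + k (p + 1) + s) = col (coordII p s))" (is "?A \<longleftrightarrow> ?B")
    if "p \<in> {1..<M}" for p
  proof
    assume A: ?A
    have "v (p, 0, s) = m (\<lambda>q i. col (coordI q i)) (\<lambda>q i. col (coordII q i)) p (\<lambda>r. h (Suc p, r, 0)) s"
      if "1 \<le> s" "s \<le> LI p + k (Suc p) + LII p" for s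
      using A that \<open>p \<in> {1..<M}\<close> by (auto simp: top_cols_def N_def)
    then show ?B by (auto simp: m_def)
  next
    assume B: ?B
    show ?A
    proof
      fix s assume s: "s \<in> {1..N p}"
      then have s: "s \<le> LI p + k (Suc p) + LII p" "1 \<le> s" using that by (auto simp: N_def)
      consider "s \<in> {1..LI p}" | r where "s = LI p + r" "r \<in> {1..k (Suc p)}"
        | i where "s = LI p + k (p + 1) + i" "i \<in> {1..LII p}"
      proof -
        assume a: "s \<in> {1..LI p} \<Longrightarrow> thesis" "\<And>r. s = LI p + r \<Longrightarrow> r \<in> {1..k (Suc p)} \<Longrightarrow> thesis"
          "\<And>i. s = LI p + k (p + 1) + i \<Longrightarrow> i \<in> {1..LII p} \<Longrightarrow> thesis"
        show thesis
          using a(1) a(2)[of "s - LI p"] a(3)[of "s - LI p - k (p + 1)"] s by fastforce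
      qed
      then show "v (p, 0, s) = top_cols col p (\<lambda>r. h (Suc p, r, 0)) s"
        using B that by cases (auto simp: top_cols_def m_def)
    qed
  qed
  have **: "(\<forall>p\<in>{1..<M}. \<forall>s\<in>{1..N p}. v (p, 0, s) = top_cols col p (\<lambda>r. h (Suc p, r, 0)) s) \<longleftrightarrow>
    (\<forall>p\<in>{1..<M}. (\<forall>r\<in>{1..k (p + 1)}. h (p + 1, r, 0) = v (p, 0, LI p + r)) \<and>
    (\<forall>s\<in>{1..LI p}. v (p, 0, s) = col (coordI p s)) \<and>
    (\<forall>s\<in>{1..LII p}. v (p, 0, LI p + k (p + 1) + s) = col (coordII p s)))"
    by (rule ball_cong[OF refl *])
  have M: "{1..M} = insert M {1..<M}" using that by auto
  have top: "(\<forall>s\<in>{1..N M}. v (M, 0, s) = top_cols col M (\<lambda>r. h (Suc M, r, 0)) s) \<longleftrightarrow>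
     (\<forall>s\<in>{1..LM}. v (M, 0, s) = col (coordM s))"
    by (simp add: N_def top_cols_def)
  have "?R \<longleftrightarrow> (\<forall>r\<in>{1..k 1}. h (1, r, 0) = 1) \<and>
     (\<forall>p\<in>{1..M}. \<forall>s\<in>{1..N p}. v (p, k p, s) = Suc p) \<and> (\<forall>p\<in>{1..M}. \<forall>r\<in>{1..k p}. h (p, r, N p) = Suc p) \<and>
     (\<forall>p\<in>{1..<M}. \<forall>s\<in>{1..N p}. v (p, 0, s) = top_cols col p (\<lambda>r. h (Suc p, r, 0)) s) \<and>
     (\<forall>s\<in>{1..N M}. v (M, 0, s) = top_cols col M (\<lambda>r. h (Suc M, r, 0)) s)"
    unfolding M by blast
  also have "\<dots> \<longleftrightarrow> boundary col h v"
    unfolding top ** boundary_def ball_conj_distrib Suc_eq_plus1[symmetric]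
    by (rule iffI; elim conjE; intro conjI; assumption)
  finally show ?thesis by simp
qed

lemma lower_psi_top:
  "M \<ge> 1 \<Longrightarrow> lower_psi x yI yII yM col M z w = lower_psi x yI yII yM col M z' w'"
proof -
  assume "M \<ge> 1"
  have "lower_psi x yI yII yM col p z w = lower_psi x yI yII yM col p z' w'"
    if "col_vars yI yII yM p z = col_vars yI yII yM p z'" "top_cols col p w = top_cols col p w'" "1 \<le> p" for p
    using that by (cases p) simp_all
  moreover have "col_vars yI yII yM M z = col_vars yI yII yM M z'" "top_cols col M w = top_cols col M w'"
    by (simp_all add: col_vars_def top_cols_def fun_eq_iff)
  ultimately show ?thesis using \<open>M \<ge> 1\<close> by blast
qed

lemma prod_of_bool: "finite A \<Longrightarrow> (\<Prod>i\<in>A. of_bool (P i)) = (of_bool (\<forall>i\<in>A. P i) :: 'b::field)"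
  by (induction A rule: finite_induct) auto

lemma top_cols_cong:
  assumes "\<And>r. r \<in> {1..k (Suc p)} \<Longrightarrow> p < M \<Longrightarrow> w r = w' r"
  shows "top_cols col p w s = top_cols col p w' s"
proof (cases "p < M \<and> \<not> s \<le> LI p \<and> s \<le> LI p + k (Suc p)")
  case True
  then have "s - LI p \<in> {1..k (Suc p)}" by simp linarith
  with True assms show ?thesis by (simp add: top_cols_def m_def)
next
  case False
  then show ?thesis by (auto simp: top_cols_def m_def)
qed

lemma psi_eq_lower_psi:
  fixes x yI yII :: "nat \<Rightarrow> nat \<Rightarrow> 'a::field" and yM :: "nat \<Rightarrow> 'a"
  assumes M: "M \<ge> 1" and adm: "admissible col"
  shows "psi x yI yII yM col = lower_psi x yI yII yM col M z w"
proof -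
  let ?C = "{1..M + 1}"
  let ?H = "h_edges \<rightarrow>\<^sub>E ?C" and ?V = "v_edges \<rightarrow>\<^sub>E ?C"
  \<comment> \<open>\<open>isum\<close> needs a background colouring with values in
    \<open>?C\<close>, and colour 1 is always there; by \<open>lower_psi_top\<close> the result is
    independent of it.\<close>
  let ?A = "\<lambda>_::edge. Suc 0"
  let ?W = "\<lambda>h v. \<Prod>p=1..M. \<Prod>r=1..k p. \<Prod>s=1..N p.
          vertex_weight (x p r) (column_var x yI yII yM p s)
            (h (p, r, s - 1)) (v (p, r, s)) (h (p, r, s)) (v (p, r - 1, s))"
  have h: "h_edges = (SIGMA q:{1..M}. {1..k q} \<times> {0..N q})" by (auto simp: h_edges_def)
  have v: "v_edges = (SIGMA q:{1..M}. {0..k q} \<times> {1..N q})" by (auto simp: v_edges_def)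
  have fin: "finite ?H" "finite ?V" unfolding h v by (intro finite_PiE; simp)+
  have D: "lower_edges M = h_edges <+> v_edges"
    unfolding lower_edges_def h v Plus_def by auto
  have Plus_iff: "Inl a \<in> h_edges <+> v_edges \<longleftrightarrow> a \<in> h_edges" "Inr a \<in> h_edges <+> v_edges \<longleftrightarrow> a \<in> v_edges" for a
    by auto
  have weight: "lower_weight x yI yII yM col M (override_on ?A (case_sum h v) (lower_edges M)) =
    (if boundary col h v then ?W h v else 0)" for h v
  proof -
    define B where "B = override_on ?A (case_sum h v) (lower_edges M)"
    have Bh: "B (he p r s) = h (p, r, s)" if "p \<in> {1..M}" "r \<in> {1..k p}" "s \<in> {0..N p}" for p r s
      unfolding B_def D using that by (auto simp: override_on_def h)
    have Bv: "B (ve p r s) = v (p, r, s)" if "p \<in> {1..M}" "r \<in> {0..k p}" "s \<in> {1..N p}" for p r s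
      unfolding B_def D using that by (auto simp: override_on_def v)
    have top: "top_cols col p (row_cols (k (Suc p)) (Suc p) B 0) s = top_cols col p (\<lambda>r. h (Suc p, r, 0)) s"
      if "p \<in> {1..M}" for p s
      by (rule top_cols_cong) (simp add: row_cols_def Bh)
    have bnd: "boundary col h v \<longleftrightarrow> (\<forall>r\<in>{1..k 1}. B (he 1 r 0) = 1) \<and>
       (\<forall>p\<in>{1..M}. \<forall>s\<in>{1..N p}. B (ve p (k p) s) = Suc p) \<and>
       (\<forall>p\<in>{1..M}. \<forall>e\<in>outer_edges p. B e = outer_cols col p B e)"
    proof -
      have a: "(\<forall>r\<in>{1..k 1}. B (he 1 r 0) = 1) \<longleftrightarrow> (\<forall>r\<in>{1..k 1}. h (1, r, 0) = 1)"
        by (intro ball_cong refl, subst Bh) (use M in auto)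
      have b: "(\<forall>s\<in>{1..N p}. B (ve p (k p) s) = Suc p) \<longleftrightarrow> (\<forall>s\<in>{1..N p}. v (p, k p, s) = Suc p)"
        "(\<forall>r\<in>{1..k p}. B (he p r (N p)) = Suc p) \<longleftrightarrow> (\<forall>r\<in>{1..k p}. h (p, r, N p) = Suc p)"
        "(\<forall>s\<in>{1..N p}. B (ve p 0 s) = top_cols col p (row_cols (k (Suc p)) (Suc p) B 0) s) \<longleftrightarrow>
         (\<forall>s\<in>{1..N p}. v (p, 0, s) = top_cols col p (\<lambda>r. h (Suc p, r, 0)) s)"
        if "p \<in> {1..M}" for p
        by (rule ball_cong[OF refl], use that in \<open>simp add: Bv\<close>)
           (rule ball_cong[OF refl], use that in \<open>simp add: Bh\<close>,
            rule ball_cong[OF refl], use that in \<open>simp add: Bv top\<close>)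
      have R: "(\<forall>p\<in>{1..M}. (\<forall>s\<in>{1..N p}. v (p, k p, s) = Suc p) \<and> (\<forall>r\<in>{1..k p}. h (p, r, N p) = Suc p) \<and>
          (\<forall>s\<in>{1..N p}. v (p, 0, s) = top_cols col p (\<lambda>r. h (Suc p, r, 0)) s)) \<longleftrightarrow>
        (\<forall>p\<in>{1..M}. (\<forall>s\<in>{1..N p}. B (ve p (k p) s) = Suc p) \<and> (\<forall>r\<in>{1..k p}. B (he p r (N p)) = Suc p) \<and>
          (\<forall>s\<in>{1..N p}. B (ve p 0 s) = top_cols col p (row_cols (k (Suc p)) (Suc p) B 0) s))"
        by (rule ball_cong[OF refl]) (simp only: b)
      show ?thesis
        unfolding boundary_iff[OF M] outer_iff a R unfolding ball_conj_distrib
        by (rule iffI; elim conjE; intro conjI; assumption)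
    qed
    have e1: "lower_weight x yI yII yM col M B = of_bool (\<forall>r\<in>{1..k 1}. B (he 1 r 0) = 1) *
       (of_bool (\<forall>p\<in>{1..M}. \<forall>s\<in>{1..N p}. B (ve p (k p) s) = Suc p) *
       of_bool (\<forall>p\<in>{1..M}. \<forall>e\<in>outer_edges p. B e = outer_cols col p B e)) *
       (\<Prod>p=1..M. \<Prod>s=1..N p. \<Prod>r=1..k p. edge_weight p (x p) (column_var x yI yII yM p) B s r)"
      unfolding lower_weight_def layer_weight_def prod.distrib
      by (simp only: prod_of_bool finite_atLeastAtMost mult_ac)
    have e2: "(\<Prod>p=1..M. \<Prod>s=1..N p. \<Prod>r=1..k p. edge_weight p (x p) (column_var x yI yII yM p) B s r) = ?W h v"
    proof (rule prod.cong[OF refl])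
      fix p assume p: "p \<in> {1..M}"
      show "(\<Prod>s=1..N p. \<Prod>r=1..k p. edge_weight p (x p) (column_var x yI yII yM p) B s r) =
        (\<Prod>r=1..k p. \<Prod>s=1..N p. vertex_weight (x p r) (column_var x yI yII yM p s)
            (h (p, r, s - 1)) (v (p, r, s)) (h (p, r, s)) (v (p, r - 1, s)))"
      proof (subst prod.swap, intro prod.cong refl)
        fix r s assume rs: "r \<in> {1..k p}" "s \<in> {1..N p}"
        then have "s - 1 \<in> {0..N p}" "s \<in> {0..N p}" "r \<in> {0..k p}" "r - 1 \<in> {0..k p}" by auto
        then show "edge_weight p (x p) (column_var x yI yII yM p) B s r =
          vertex_weight (x p r) (column_var x yI yII yM p s)
            (h (p, r, s - 1)) (v (p, r, s)) (h (p, r, s)) (v (p, r - 1, s))"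
          by (simp only: Bh Bv p rs)
      qed
    qed
    have e3: "of_bool P * (of_bool Q * of_bool R) * X = (if P \<and> Q \<and> R then X else 0)" for P Q R and X :: 'a
      by simp
    show ?thesis unfolding B_def[symmetric] e1 e2 bnd by (rule e3)
  qed
  have "psi x yI yII yM col = (\<Sum>(h, v)\<in>{hv \<in> ?H \<times> ?V. boundary col (fst hv) (snd hv)}. ?W h v)"
    unfolding psi_def by (rule sum.cong) (auto simp: edge_colourings_def)
  also have "\<dots> = (\<Sum>(h, v)\<in>?H \<times> ?V. if boundary col h v then ?W h v else 0)"
    using fin by (subst sum.inter_filter) (auto intro!: sum.cong)
  also have "\<dots> = isum ?C (lower_edges M) (lower_weight x yI yII yM col M) ?A"
    unfolding isum_def
  \<comment> \<open>A pair of extensional colourings corresponds to one extensional function on the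
    disjoint union of the edge sets.\<close>
  proof (rule sum.reindex_bij_witness[where i = "\<lambda>f. (f \<circ> Inl, f \<circ> Inr)" and j = "\<lambda>(h, v). case_sum h v"])
    fix f assume "f \<in> lower_edges M \<rightarrow>\<^sub>E ?C"
    then have f: "f \<in> (h_edges <+> v_edges) \<rightarrow>\<^sub>E ?C" by (simp add: D)
    show "(case (f \<circ> Inl, f \<circ> Inr) of (h, v) \<Rightarrow> case_sum h v) = f"
      by (auto simp: fun_eq_iff split: sum.split)
    show "(f \<circ> Inl, f \<circ> Inr) \<in> ?H \<times> ?V"
      using f by (auto simp: PiE_iff extensional_def)
  next
    fix hv assume "hv \<in> ?H \<times> ?V"
    then show "((case hv of (h, v) \<Rightarrow> case_sum h v) \<circ> Inl, (case hv of (h, v) \<Rightarrow> case_sum h v) \<circ> Inr) = hv"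
      by (auto simp: fun_eq_iff)
    obtain h v where hv: "hv = (h, v)" "h \<in> ?H" "v \<in> ?V" using \<open>hv \<in> _\<close> by auto
    have "case_sum h v \<in> lower_edges M \<rightarrow>\<^sub>E ?C"
    proof (rule PiE_I)
      fix e assume "e \<in> lower_edges M"
      then show "case_sum h v e \<in> ?C"
        using PiE_mem[OF hv(2)] PiE_mem[OF hv(3)] unfolding D by (cases e) auto
    next
      fix e assume "e \<notin> lower_edges M"
      then show "case_sum h v e = undefined"
        unfolding D by (cases e) (simp_all add: Plus_iff PiE_arb[OF hv(2)] PiE_arb[OF hv(3)])
    qed
    then show "(case hv of (h, v) \<Rightarrow> case_sum h v) \<in> lower_edges M \<rightarrow>\<^sub>E ?C"
      by (simp only: hv prod.case)
    show "lower_weight x yI yII yM col M (override_on ?A (case hv of (h, v) \<Rightarrow> case_sum h v) (lower_edges M)) =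
      (case hv of (h, v) \<Rightarrow> if boundary col h v then ?W h v else 0)"
      by (simp only: hv weight prod.case)
  qed
  also have "\<dots> = lower_psi x yI yII yM col M z w"
    by (subst isum_lower[OF adm order_refl]) (auto intro: lower_psi_top[OF M])
  finally show ?thesis .
qed

end

section \<open>Positions of the non-vacuum colours\<close>

lemma nth_smallest_eq:
  assumes "strict_mono_on {1..n} f" "f ` {1..n} = A" "a \<in> {1..n}"
  shows "nth_smallest A a = f a"
proof -
  let ?l = "map f [1..<Suc n]"
  have *: "set [1..<Suc n] = {1..n}" by auto
  have "sorted_wrt (<) ?l"
    unfolding sorted_wrt_map
    by (rule sorted_wrt_mono_rel[OF _ sorted_wrt_upt]) (use assms(1) in \<open>auto simp: * strict_mono_on_def\<close>)
  moreover have "set ?l = A" unfolding set_map * by (rule assms(2))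
  moreover have "card A = n"
    using assms(2) card_image[OF strict_mono_on_imp_inj_on[OF assms(1)]] by simp
  moreover have "finite A" using assms(2) by auto
  ultimately have "sorted_list_of_set A = ?l"
    by (subst sorted_list_of_set_unique[symmetric]) auto
  moreover have "a - 1 < length [1..<Suc n]" "1 + (a - 1) < Suc n" "1 + (a - 1) = a"
    using assms(3) by auto
  ultimately show ?thesis by (simp only: nth_smallest_def nth_map nth_upt)
qed

lemma nth_smallest_enum:
  assumes "finite A" "card A = n"
  shows "strict_mono_on {1..n} (nth_smallest A)" "nth_smallest A ` {1..n} = A"
proof -
  let ?l = "sorted_list_of_set A"
  have l: "length ?l = n" using assms by simp
  show "strict_mono_on {1..n} (nth_smallest A)"
  proof (rule strict_mono_onI)
    fix a b assume ab: "a \<in> {1..n}" "b \<in> {1..n}" "a < b"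
    then show "nth_smallest A a < nth_smallest A b"
      unfolding nth_smallest_def using l
      by (intro sorted_wrt_nth_less[OF strict_sorted_list_of_set]) auto
  qed
  have "(\<lambda>a. ?l ! (a - 1)) ` {1..n} = (!) ?l ` {..<n}"
  proof -
    have "{..<n} = (\<lambda>a. a - 1) ` {1..n}"
      by (auto simp: image_iff intro!: bexI[of _ "Suc _"])
    then show ?thesis by (simp add: image_image)
  qed
  also have "\<dots> = set ?l" using l by (auto simp: set_conv_nth)
  finally show "nth_smallest A ` {1..n} = A" using assms by (simp add: nth_smallest_def[abs_def])
qed

lemma sum_PiE_insert:
  assumes "e \<notin> D"
  shows "(\<Sum>\<sigma>\<in>PiE (insert e D) C. H \<sigma>) = (\<Sum>\<tau>\<in>C e. \<Sum>\<sigma>\<in>PiE D C. H (\<sigma>(e := \<tau>)))"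
  unfolding PiE_insert_eq sum.cartesian_product
  by (subst sum.reindex[OF inj_combinator[OF assms]]) (auto intro!: sum.cong)

context layers
begin

section \<open>Exchange relation for the stacked layers\<close>

lemma m_transpose:
  assumes "1 \<le> a" "Suc a \<le> k (Suc p)"
  shows "m A B p (w \<circ> transpose a (Suc a)) = m A B p w \<circ> transpose (LI p + a) (Suc (LI p + a))"
proof
  fix i
  consider "i = LI p + a" | "i = Suc (LI p + a)" | "i \<noteq> LI p + a" "i \<noteq> Suc (LI p + a)" by blast
  then show "m A B p (w \<circ> transpose a (Suc a)) i = (m A B p w \<circ> transpose (LI p + a) (Suc (LI p + a))) i"
  proof cases
    case 3
    then have "transpose (LI p + a) (Suc (LI p + a)) i = i" by simp
    moreover have "transpose a (Suc a) (i - LI p) = i - LI p" if "\<not> i \<le> LI p"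
      using that 3 by (intro transpose_apply_other) auto
    ultimately show ?thesis by (simp add: m_def)
  qed (use assms in \<open>simp_all add: m_def Suc_diff_le\<close>)
qed

text \<open>The variables \<open>z a\<close>, \<open>z (Suc a)\<close> and the colours
  \<open>w a\<close>, \<open>w (Suc a)\<close> belong to the adjacent columns
  \<open>LI p + a\<close> and its successor of layer \<open>p\<close>, so the column exchange
  applies. For \<open>p = 0\<close> the function is symmetric in the rows and constant in
  \<open>z\<close>.\<close>

lemma lower_psi_exch:
  fixes x yI yII :: "nat \<Rightarrow> nat \<Rightarrow> 'a::field" and yM :: "nat \<Rightarrow> 'a"
  assumes "p < M" "1 \<le> a" "Suc a \<le> k (Suc p)"
  shows "exch (z a - z (Suc a)) a (lower_psi x yI yII yM col p z)
    (lower_psi x yI yII yM col p (z \<circ> transpose a (Suc a)))"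
proof (cases p)
  case 0
  have "transpose a (Suc a) ` {1..k 1} = {1..k 1}"
    by (rule permutes_image[OF permutes_swap_id]) (use assms 0 in auto)
  then have "(\<forall>r\<in>{1..k 1}. (w \<circ> transpose a (Suc a)) r = 1) \<longleftrightarrow> (\<forall>r\<in>{1..k 1}. w r = 1)" for w :: "nat \<Rightarrow> nat"
    by (metis (no_types, lifting) comp_apply imageE imageI)
  then show ?thesis unfolding 0 exch_def lower_psi.simps by (simp add: algebra_simps)
next
  case (Suc q)
  let ?s = "LI p + a"
  let ?Y = "col_vars yI yII yM p z"
  have Y: "?Y ?s = z a" "?Y (Suc ?s) = z (Suc a)"
    using assms by (simp_all add: col_vars_def m_def)
  have "col_vars yI yII yM p (z \<circ> transpose a (Suc a)) = ?Y \<circ> transpose ?s (Suc ?s)"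
    using m_transpose[OF assms(2,3), of yI yII z] assms(1) by (simp add: col_vars_def fun_eq_iff)
  moreover have "top_cols col p (w \<circ> transpose a (Suc a)) = top_cols col p w \<circ> transpose ?s (Suc ?s)" for w
    using m_transpose[OF assms(2,3), of "\<lambda>q i. col (coordI q i)" "\<lambda>q i. col (coordII q i)" w] assms(1)
    by (simp add: top_cols_def fun_eq_iff)
  ultimately show ?thesis
    unfolding exch_def Suc lower_psi.simps
    using layer_op_exch_column[of ?s "N p" ?Y] Y assms
    by (simp add: Suc[symmetric] N_def del: comp_apply)
qed

section \<open>Coordinates as columns of a layer\<close>

text \<open>
  \<open>coord col p s\<close> is the coordinate with relabelled index \<open>s\<close> in layer \<open>p\<close>: \<open>coord col p\<close> enumerates
  in increasing order the elements of \<open>I_hat p\<close> with colour at most \<open>p + 1\<close>.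
\<close>

definition coord :: "(nat \<Rightarrow> nat) \<Rightarrow> nat \<Rightarrow> nat \<Rightarrow> nat" where
  "coord col p s =
     (if p < M then m coordI coordII p (nth_smallest (I_set col (Suc p))) s else coordM s)"

text \<open>The left-edge colours at which \<open>layer_op_formula\<close> evaluates the function of
  the layers below, as \<open>row_colours_eq\<close> shows.\<close>

definition row_colours :: "(nat \<Rightarrow> nat) \<Rightarrow> nat \<Rightarrow> nat \<Rightarrow> nat" where
  "row_colours col p r = (if r \<in> {1..k p} then col (nth_smallest (I_set col p) r) else 0)"

lemma top_cols_row_colours:
  "top_cols col p (row_colours col (Suc p)) s = col (coord col p s)" if "s \<in> {1..N p}"
  using that by (auto simp: top_cols_def coord_def m_def row_colours_def)

text \<open>The order of the variables is nested: layers \<open>j\<close> and higher occupy one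
  stretch, enclosed by the first and second blocks of the lower layers.\<close>

lemma I_hat_bounds:
  assumes "c \<in> I_hat j" "1 \<le> j"
  shows "sum LI {1..<j} < c \<and> c \<le> ell + LM + sum LII {j..<M}"
proof -
  obtain p where p: "j \<le> p" "p \<le> M" "c \<in> layer_coords p" using assms by (auto simp: I_hat_def)
  have 1: "sum LI {1..<j} \<le> sum LI {1..<p}" using p by (intro sum_mono2) auto
  have 2: "sum LI {1..<p} \<le> ell" unfolding ell_def using p by (intro sum_mono2) auto
  show ?thesis
  proof (cases "p < M")
    case True
    have 3: "sum LI {1..<p} + LI p \<le> ell"
    proof -
      have "sum LI {1..<p} + LI p = sum LI {1..<Suc p}" using p assms(2) by simp
      also have "\<dots> \<le> ell" unfolding ell_def using True by (intro sum_mono2) auto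
      finally show ?thesis .
    qed
    have 4: "LII p + sum LII {p<..<M} \<le> sum LII {j..<M}"
    proof -
      have "{p..<M} = insert p {p<..<M}" using True by auto
      then have "LII p + sum LII {p<..<M} = sum LII {p..<M}" by simp
      also have "\<dots> \<le> sum LII {j..<M}" using p by (intro sum_mono2) auto
      finally show ?thesis .
    qed
    from p(3) True consider i where "i \<in> {1..LI p}" "c = coordI p i" | i where "i \<in> {1..LII p}" "c = coordII p i"
      by (auto simp: layer_coords_def)
    then show ?thesis
      by cases (use 1 2 3 4 in \<open>auto simp: coordI_def coordII_def\<close>)
  next
    case False
    then show ?thesis using p 1 2 by (auto simp: layer_coords_def coordM_def)
  qed
qed

lemma I_set_facts:
  assumes "admissible col" "p \<in> {1..M}"
  shows "finite (I_set col p)" "card (I_set col p) = k p"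
proof -
  have "finite (layer_coords q)" for q by (simp add: layer_coords_def)
  then have "finite (I_hat p)" by (auto simp: I_hat_def)
  then show "finite (I_set col p)" by (rule rev_finite_subset) (auto simp: I_set_def)
  show "card (I_set col p) = k p" using assms by (auto simp: admissible_def)
qed

text \<open>Each of the three blocks is increasing, and \<open>I_hat_bounds\<close> places the
  middle one, made of coordinates of higher layers, between the other two.\<close>

lemma coord_mono:
  assumes "admissible col" "p \<in> {1..M}"
  shows "strict_mono_on {1..N p} (coord col p)"
proof (cases "p < M")
  case False
  then show ?thesis by (auto simp: strict_mono_on_def coord_def coordM_def)
next
  case True
  let ?I = "nth_smallest (I_set col (Suc p))"
  have q: "Suc p \<in> {1..M}" using True by auto
  note e = nth_smallest_enum[OF I_set_facts[OF assms(1) q]]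
  have b: "sum LI {1..<Suc p} < ?I r \<and> ?I r \<le> ell + LM + sum LII {Suc p..<M}" if "r \<in> {1..k (Suc p)}" for r
  proof -
    have "?I r \<in> I_set col (Suc p)" using e(2) that by blast
    then show ?thesis using I_hat_bounds[of "?I r" "Suc p"] by (simp add: I_set_def)
  qed
  have ell: "sum LI {1..<Suc p} \<le> ell" unfolding ell_def using True by (intro sum_mono2) auto
  have LIp: "sum LI {1..<Suc p} = sum LI {1..<p} + LI p" using assms by simp
  have II: "{Suc p..<M} = {p<..<M}" by auto
  show ?thesis
  proof (rule strict_mono_onI)
    fix s s' assume s: "s \<in> {1..N p}" "s' \<in> {1..N p}" "s < s'"
    let ?L = "LI p" and ?K = "k (Suc p)"
    have N: "s' \<le> ?L + ?K + LII p" using s True by (simp add: N_def)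
    have r: "s - ?L \<in> {1..?K}" if "\<not> s \<le> ?L" "s \<le> ?L + ?K" for s using that by (simp; linarith)
    consider "s' \<le> ?L" | "s \<le> ?L" "\<not> s' \<le> ?L" "s' \<le> ?L + ?K" | "s \<le> ?L" "\<not> s' \<le> ?L + ?K"
      | "\<not> s \<le> ?L" "s' \<le> ?L + ?K" | "\<not> s \<le> ?L" "s \<le> ?L + ?K" "\<not> s' \<le> ?L + ?K" | "\<not> s \<le> ?L + ?K"
      using s(3) by linarith
    then show "coord col p s < coord col p s'"
    proof cases
      case 2
      then show ?thesis using b[OF r[of s']] True LIp by (simp add: coord_def m_def coordI_def)
    next
      case 4
      then have "?I (s - ?L) < ?I (s' - ?L)"
        using s by (intro strict_mono_onD[OF e(1)] r) auto
      then show ?thesis using 4 s True by (simp add: coord_def m_def)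
    next
      case 5
      then show ?thesis using b[OF r[of s]] True II by (simp add: coord_def m_def coordII_def) linarith
    qed (use s True ell LIp N in \<open>auto simp: coord_def m_def coordI_def coordII_def\<close>)
  qed
qed

text \<open>A coordinate of layer \<open>p\<close> always has colour at most \<open>p + 1\<close>;
  one of a higher layer has such a colour exactly if it lies in \<open>I_set col (Suc p)\<close>,
  which fills the middle block.\<close>

lemma coord_image:
  assumes "admissible col" "p \<in> {1..M}"
  shows "coord col p ` {1..N p} = {c \<in> I_hat p. col c \<in> {1..Suc p}}"
proof -
  have lay: "col c \<in> {1..Suc p}" if "c \<in> layer_coords p" for c
    using that assms by (auto simp: admissible_def)
  show ?thesis
  proof (cases "p < M")
    case False
    then have "p = M" using assms by auto
    then show ?thesis using lay by (auto simp: coord_def I_hat_def layer_coords_def N_def)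
  next
    case True
    have q: "Suc p \<in> {1..M}" using True by auto
    note e = nth_smallest_enum(2)[OF I_set_facts[OF assms(1) q]]
    have "{p..M} = insert p {Suc p..M}" using True by auto
    then have "I_hat p = layer_coords p \<union> I_hat (Suc p)" by (simp add: I_hat_def)
    then have R: "{c \<in> I_hat p. col c \<in> {1..Suc p}} = layer_coords p \<union> I_set col (Suc p)"
      using lay by (auto simp: I_set_def)
    let ?L = "LI p" and ?K = "k (Suc p)"
    have s: "{1..N p} = {1..?L} \<union> (\<lambda>r. ?L + r) ` {1..?K} \<union> (\<lambda>r. ?L + ?K + r) ` {1..LII p}"
    proof -
      have "s \<in> (\<lambda>r. ?L + r) ` {1..?K}" if "\<not> s \<le> ?L" "s \<le> ?L + ?K" for s
        using that by (intro image_eqI[of _ _ "s - ?L"]) auto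
      moreover have "s \<in> (\<lambda>r. ?L + ?K + r) ` {1..LII p}" if "\<not> s \<le> ?L + ?K" "s \<le> N p" for s
        using that True by (intro image_eqI[of _ _ "s - ?L - ?K"]) (auto simp: N_def)
      ultimately show ?thesis using True by (auto simp: N_def)
    qed
    have "coord col p ` {1..?L} = coordI p ` {1..?L}"
      by (rule image_cong) (use True in \<open>auto simp: coord_def m_def\<close>)
    moreover have "coord col p ` (\<lambda>r. ?L + r) ` {1..?K} = nth_smallest (I_set col (Suc p)) ` {1..?K}"
      unfolding image_image by (rule image_cong) (use True in \<open>auto simp: coord_def m_def\<close>)
    moreover have "coord col p ` (\<lambda>r. ?L + ?K + r) ` {1..LII p} = coordII p ` {1..LII p}"
      unfolding image_image by (rule image_cong) (use True in \<open>auto simp: coord_def m_def\<close>)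
    ultimately show ?thesis
      unfolding s image_Un e R using True by (auto simp: layer_coords_def)
  qed
qed

definition pos :: "(nat \<Rightarrow> nat) \<Rightarrow> nat \<Rightarrow> nat \<Rightarrow> nat" where
  "pos col p a = (if p < M then nth_smallest (I_tilde col p) a else nth_smallest (I_set col M) a - ell)"

text \<open>The increasing map \<open>coord col p\<close> carries the non-vacuum columns onto
  \<open>I_set col p\<close>, so it matches their enumerations; \<open>relabel\<close> is its
  inverse, which identifies the columns with \<open>I_tilde\<close>.\<close>

lemma pos_facts:
  assumes adm: "admissible col" and p: "p \<in> {1..M}"
  shows "strict_mono_on {1..k p} (pos col p)"
    and "pos col p ` {1..k p} = {i \<in> {1..N p}. col (coord col p i) \<noteq> Suc p}"
    and "\<And>a. a \<in> {1..k p} \<Longrightarrow> coord col p (pos col p a) = nth_smallest (I_set col p) a"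
proof -
  let ?A = "{i \<in> {1..N p}. col (coord col p i) \<noteq> Suc p}"
  define g where "g = nth_smallest ?A"
  note mono = coord_mono[OF adm p] and im = coord_image[OF adm p]
  have inj: "inj_on (coord col p) {1..N p}" by (rule strict_mono_on_imp_inj_on[OF mono])
  have cA: "coord col p ` ?A = I_set col p"
  proof
    show "coord col p ` ?A \<subseteq> I_set col p"
    proof
      fix c assume "c \<in> coord col p ` ?A"
      then have "c \<in> coord col p ` {1..N p}" "col c \<noteq> Suc p" by auto
      then show "c \<in> I_set col p" unfolding im by (auto simp: I_set_def)
    qed
    show "I_set col p \<subseteq> coord col p ` ?A"
    proof
      fix c assume c: "c \<in> I_set col p"
      then have "c \<in> coord col p ` {1..N p}" unfolding im by (auto simp: I_set_def)
      moreover have "col c \<noteq> Suc p" using c by (auto simp: I_set_def)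
      ultimately show "c \<in> coord col p ` ?A" by auto
    qed
  qed
  have injA: "inj_on (coord col p) ?A" by (rule inj_on_subset[OF inj]) auto
  have card: "card ?A = k p"
    using card_image[OF injA] I_set_facts(2)[OF adm p] unfolding cA by (rule trans[OF sym])
  have fA: "finite ?A" by simp
  note f = nth_smallest_enum[OF fA card, folded g_def]
  have eq: "nth_smallest (I_set col p) a = coord col p (g a)" if a: "a \<in> {1..k p}" for a
  proof -
    have 1: "strict_mono_on {1..k p} (coord col p \<circ> g)"
    proof (rule strict_mono_onI)
      fix a b assume ab: "a \<in> {1..k p}" "b \<in> {1..k p}" "a < b"
      have "g a \<in> ?A" "g b \<in> ?A" unfolding f(2)[symmetric] by (rule imageI, fact)+
      then show "(coord col p \<circ> g) a < (coord col p \<circ> g) b"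
        using strict_mono_onD[OF f(1) ab] unfolding o_apply by (intro strict_mono_onD[OF mono]) simp_all
    qed
    have 2: "(coord col p \<circ> g) ` {1..k p} = I_set col p"
      unfolding image_comp[symmetric] f(2) cA ..
    show ?thesis using nth_smallest_eq[OF 1 2 a] unfolding o_apply .
  qed
  have pos: "pos col p a = g a" if a: "a \<in> {1..k p}" for a
  proof (cases "p < M")
    case False
    then show ?thesis using eq[OF a] p by (auto simp: pos_def coord_def coordM_def)
  next
    case True
    \<comment> \<open>\<open>relabel\<close> counts the eligible coordinates up to the given one;
      these are the images of the columns \<open>1\<close> to \<open>i\<close>.\<close>
    have rel: "relabel col p (coord col p i) = i" if i: "i \<in> {1..N p}" for i
    proof -
      have "{d \<in> I_hat p. col d \<in> {1..p + 1} \<and> d \<le> coord col p i} = {d \<in> coord col p ` {1..N p}. d \<le> coord col p i}"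
        unfolding im by auto
      also have "\<dots> = coord col p ` {1..i}"
      proof -
        have "coord col p j \<le> coord col p i \<longleftrightarrow> j \<le> i" if j: "j \<in> {1..N p}" for j
          using strict_mono_on_leD[OF mono j i] strict_mono_onD[OF mono i j] by (meson not_le)
        then show ?thesis using i by auto
      qed
      finally have "relabel col p (coord col p i) = card (coord col p ` {1..i})" by (simp add: relabel_def)
      also have "\<dots> = i"
        using i by (subst card_image[OF inj_on_subset[OF inj]]) auto
      finally show ?thesis .
    qed
    have "I_tilde col p = relabel col p ` coord col p ` ?A" unfolding I_tilde_def cA ..
    also have "\<dots> = (\<lambda>i. i) ` ?A" unfolding image_image by (rule image_cong) (auto simp: rel)
    finally show ?thesis using True by (simp add: pos_def g_def)
  qed
  show "strict_mono_on {1..k p} (pos col p)"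
    using f(1) by (auto intro!: strict_mono_onI simp: pos dest: strict_mono_onD)
  show "pos col p ` {1..k p} = ?A" unfolding f(2)[symmetric] by (rule image_cong[OF refl pos])
  show "coord col p (pos col p a) = nth_smallest (I_set col p) a" if "a \<in> {1..k p}" for a
    using pos[OF that] eq[OF that] by simp
qed

section \<open>Comparison with the weight function\<close>

lemma row_colours_eq:
  assumes "admissible col" "p \<in> {1..M}"
  shows "(\<lambda>r. if r \<in> {1..k p} then top_cols col p (row_colours col (Suc p)) (pos col p r) else vac_row p r) =
    row_colours col p"
proof
  fix r
  have "pos col p r \<in> {1..N p}" if "r \<in> {1..k p}"
    using pos_facts(2)[OF assms] that by blast
  then show "(if r \<in> {1..k p} then top_cols col p (row_colours col (Suc p)) (pos col p r) else vac_row p r) =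
    row_colours col p r"
    using pos_facts(3)[OF assms] by (simp add: top_cols_row_colours row_colours_def)
qed

definition layer_factor ::
  "(nat \<Rightarrow> nat \<Rightarrow> 'a::field) \<Rightarrow> (nat \<Rightarrow> nat \<Rightarrow> 'a) \<Rightarrow> (nat \<Rightarrow> 'a) \<Rightarrow> (nat \<Rightarrow> nat) \<Rightarrow> nat \<Rightarrow>
   (nat \<Rightarrow> 'a) \<Rightarrow> (nat \<Rightarrow> 'a) \<Rightarrow> 'a" where
  "layer_factor yI yII yM col p z z' =
     (\<Prod>a=1..k p. row_factor (pos col p) z (col_vars yI yII yM p z') (N p) a) * pair_factor (k p) z"

text \<open>All right edges of a layer carry the vacuum, so \<open>layer_op_formula\<close> applies
  with \<open>t = k (Suc p)\<close> and the product over the remaining rows is empty.\<close>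

lemma lower_psi_layer:
  fixes x yI yII :: "nat \<Rightarrow> nat \<Rightarrow> 'a::field" and yM :: "nat \<Rightarrow> 'a"
  assumes adm: "admissible col" and p: "Suc p \<le> M" and inj: "inj_on (x (Suc p)) {1..k (Suc p)}"
  shows "lower_psi x yI yII yM col (Suc p) z (row_colours col (Suc (Suc p))) =
    (\<Sum>\<tau> | \<tau> permutes {1..k (Suc p)}.
       lower_psi x yI yII yM col p (x (Suc p) \<circ> \<tau>) (row_colours col (Suc p)) *
       layer_factor yI yII yM col (Suc p) (x (Suc p) \<circ> \<tau>) z)"
proof -
  let ?q = "Suc p"
  have q: "?q \<in> {1..M}" using p by auto
  let ?u = "top_cols col ?q (row_colours col (Suc ?q))"
  have im: "pos col ?q ` {1..k ?q} = {i \<in> {1..N ?q}. ?u i \<noteq> Suc ?q}"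
    unfolding pos_facts(2)[OF adm q] by (auto simp: top_cols_row_colours)
  have "lower_psi x yI yII yM col ?q z (row_colours col (Suc ?q)) =
    (\<Sum>\<tau> | \<tau> permutes {1..k ?q}. lower_psi x yI yII yM col p (x ?q \<circ> \<tau>)
         (\<lambda>r. if r \<in> {1..k ?q} then ?u (pos col ?q r) else vac_row ?q r) *
       (\<Prod>a=1..k ?q. row_factor (pos col ?q) (x ?q \<circ> \<tau>) (col_vars yI yII yM ?q z) (N ?q) a) *
       pair_factor (k ?q) (x ?q \<circ> \<tau>)) *
    (\<Prod>a\<in>{k ?q<..k ?q}. \<Prod>i=1..N ?q. x ?q a - col_vars yI yII yM ?q z i)"
    unfolding lower_psi.simps
  proof (rule layer_op_formula[where f = "lower_psi x yI yII yM col p", OF _ order_refl pos_facts(1)[OF adm q] im _ _ inj])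
    show "exch (z a - z (Suc a)) a (lower_psi x yI yII yM col p z)
        (lower_psi x yI yII yM col p (z \<circ> transpose a (Suc a)))" if "1 \<le> a" "Suc a \<le> k ?q" for a z
      using p that by (intro lower_psi_exch) auto
  qed auto
  then show ?thesis
    unfolding row_colours_eq[OF adm q] by (simp add: layer_factor_def mult.assoc)
qed

text \<open>\<open>z\<close> stays general because the induction hypothesis is applied to the
  permuted list \<open>x (Suc p) \<circ> \<tau>\<close>, whose entries are column variables one
  layer below.\<close>

lemma lower_psi_eq_sum:
  fixes x yI yII :: "nat \<Rightarrow> nat \<Rightarrow> 'a::field" and yM :: "nat \<Rightarrow> 'a"
  assumes adm: "admissible col" and inj: "\<forall>p\<in>{1..M}. inj_on (x p) {1..k p}" and p: "p \<le> M" and M: "1 \<le> M"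
  shows "lower_psi x yI yII yM col p z (row_colours col (Suc p)) =
    (\<Sum>\<sigma>\<in>(\<Pi>\<^sub>E q\<in>{1..p}. {\<pi>. \<pi> permutes {1..k q}}).
       \<Prod>q=1..p. layer_factor yI yII yM col q (x q \<circ> \<sigma> q) (if q = p then z else x (Suc q) \<circ> \<sigma> (Suc q)))"
  using p
proof (induction p arbitrary: z)
  case 0
  \<comment> \<open>Elements of \<open>I_set col 1\<close> have colour 1, so the left boundary
    condition of layer 1 holds.\<close>
  have "row_colours col 1 r = 1" if r: "r \<in> {1..k 1}" for r
  proof -
    have "nth_smallest (I_set col 1) r \<in> I_set col 1"
      using nth_smallest_enum(2)[OF I_set_facts[OF adm, of 1]] M r by auto
    then show ?thesis using r by (auto simp: row_colours_def I_set_def)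
  qed
  then show ?case by simp
next
  case (Suc p)
  let ?q = "Suc p"
  let ?P = "\<lambda>q. {\<pi>. \<pi> permutes {1..k q}}"
  let ?F = "\<lambda>\<sigma> q. layer_factor yI yII yM col q (x q \<circ> \<sigma> q)"
  have q: "{1..?q} = insert ?q {1..p}" by auto
  have "lower_psi x yI yII yM col ?q z (row_colours col (Suc ?q)) =
    (\<Sum>\<tau>\<in>?P ?q. (\<Sum>\<sigma>\<in>PiE {1..p} ?P.
       \<Prod>q=1..p. ?F \<sigma> q (if q = p then x ?q \<circ> \<tau> else x (Suc q) \<circ> \<sigma> (Suc q))) *
       layer_factor yI yII yM col ?q (x ?q \<circ> \<tau>) z)"
  proof -
    have "inj_on (x ?q) {1..k ?q}" using inj Suc.prems by simp
    then show ?thesis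
      by (simp only: lower_psi_layer[OF adm Suc.prems] Suc.IH[OF Suc_leD[OF Suc.prems]])
  qed
  also have "\<dots> = (\<Sum>\<tau>\<in>?P ?q. \<Sum>\<sigma>\<in>PiE {1..p} ?P.
      \<Prod>q\<in>insert ?q {1..p}. ?F (\<sigma>(?q := \<tau>)) q (if q = ?q then z else x (Suc q) \<circ> (\<sigma>(?q := \<tau>)) (Suc q)))"
  proof (intro sum.cong refl)
    fix \<tau>
    have step: "(\<Prod>q=1..p. ?F \<sigma> q (if q = p then x ?q \<circ> \<tau> else x (Suc q) \<circ> \<sigma> (Suc q))) *
       layer_factor yI yII yM col ?q (x ?q \<circ> \<tau>) z =
      (\<Prod>q\<in>insert ?q {1..p}. ?F (\<sigma>(?q := \<tau>)) q (if q = ?q then z else x (Suc q) \<circ> (\<sigma>(?q := \<tau>)) (Suc q)))"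
      for \<sigma>
    proof -
      have "(\<Prod>q=1..p. ?F \<sigma> q (if q = p then x ?q \<circ> \<tau> else x (Suc q) \<circ> \<sigma> (Suc q))) =
        (\<Prod>q=1..p. ?F (\<sigma>(?q := \<tau>)) q (if q = ?q then z else x (Suc q) \<circ> (\<sigma>(?q := \<tau>)) (Suc q)))"
        by (rule prod.cong) auto
      then show ?thesis by (subst prod.insert) (simp_all only: fun_upd_same, simp_all)
    qed
    show "(\<Sum>\<sigma>\<in>PiE {1..p} ?P.
       \<Prod>q=1..p. ?F \<sigma> q (if q = p then x ?q \<circ> \<tau> else x (Suc q) \<circ> \<sigma> (Suc q))) *
       layer_factor yI yII yM col ?q (x ?q \<circ> \<tau>) z =
      (\<Sum>\<sigma>\<in>PiE {1..p} ?P.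
      \<Prod>q\<in>insert ?q {1..p}. ?F (\<sigma>(?q := \<tau>)) q (if q = ?q then z else x (Suc q) \<circ> (\<sigma>(?q := \<tau>)) (Suc q)))"
      by (simp only: sum_distrib_right step)
  qed
  also have "\<dots> = (\<Sum>\<sigma>\<in>PiE {1..?q} ?P.
      \<Prod>q=1..?q. ?F \<sigma> q (if q = ?q then z else x (Suc q) \<circ> \<sigma> (Suc q)))"
    unfolding q by (rule sum_PiE_insert[symmetric]) simp
  finally show ?case .
qed

lemma layer_factor_lower:
  assumes "p < M"
  shows "layer_factor yI yII yM col p z z' =
    (\<Prod>a=1..k p. (\<Prod>i=1..nth_smallest (I_tilde col p) a - 1. z a - m yI yII p z' i) *
       (\<Prod>i=nth_smallest (I_tilde col p) a + 1..N p. z a - m yI yII p z' i + 1)) * pair_factor (k p) z"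
  using assms by (simp add: layer_factor_def row_factor_def pos_def col_vars_def)

text \<open>Column \<open>i\<close> of layer \<open>M\<close> is coordinate \<open>ell + i\<close>,
  which accounts for the shifts by \<open>ell\<close>.\<close>

lemma layer_factor_top:
  assumes "admissible col" "1 \<le> M"
  shows "layer_factor yI yII yM col M z z' =
    (\<Prod>a=1..k M. (\<Prod>i=1..nth_smallest (I_set col M) a - 1 - ell. z a - yM i) *
       (\<Prod>i=nth_smallest (I_set col M) a + 1 - ell..LM. z a - yM i + 1)) * pair_factor (k M) z"
proof -
  have M: "M \<in> {1..M}" using assms(2) by simp
  have "row_factor (pos col M) z (col_vars yI yII yM M z') (N M) a =
    (\<Prod>i=1..nth_smallest (I_set col M) a - 1 - ell. z a - yM i) *
       (\<Prod>i=nth_smallest (I_set col M) a + 1 - ell..LM. z a - yM i + 1)" if "a \<in> {1..k M}" for a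
  proof -
    have c: "nth_smallest (I_set col M) a = ell + pos col M a"
      using pos_facts(3)[OF assms(1) M that] by (simp add: coord_def coordM_def)
    have "nth_smallest (I_set col M) a - 1 - ell = pos col M a - 1"
      "nth_smallest (I_set col M) a + 1 - ell = pos col M a + 1" unfolding c by simp_all
    then show ?thesis by (simp add: row_factor_def col_vars_def N_def)
  qed
  then show ?thesis by (simp add: layer_factor_def)
qed

theorem psi_eq_W:
  fixes x yI yII :: "nat \<Rightarrow> nat \<Rightarrow> 'a::field" and yM :: "nat \<Rightarrow> 'a"
  assumes M: "M \<ge> 1" and adm: "admissible col" and inj: "\<forall>p\<in>{1..M}. inj_on (x p) {1..k p}"
  shows "psi x yI yII yM col = W x yI yII yM col"
proof -
  have "psi x yI yII yM col = lower_psi x yI yII yM col M (x (Suc M)) (row_colours col (Suc M))"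
    by (rule psi_eq_lower_psi[OF M adm])
  also have "\<dots> = (\<Sum>\<sigma>\<in>(\<Pi>\<^sub>E q\<in>{1..M}. {\<pi>. \<pi> permutes {1..k q}}).
       \<Prod>q=1..M. layer_factor yI yII yM col q (x q \<circ> \<sigma> q) (if q = M then x (Suc M) else x (Suc q) \<circ> \<sigma> (Suc q)))"
    by (rule lower_psi_eq_sum[OF adm inj order_refl M])
  also have "\<dots> = W x yI yII yM col"
    unfolding W_def Let_def
  proof (rule sum.cong[OF refl])
    fix \<sigma>
    have "{1..M} = insert M {1..<M}" using M by auto
    then have "(\<Prod>q=1..M. layer_factor yI yII yM col q (x q \<circ> \<sigma> q) (if q = M then x (Suc M) else x (Suc q) \<circ> \<sigma> (Suc q))) =
      (\<Prod>q\<in>{1..<M}. layer_factor yI yII yM col q (x q \<circ> \<sigma> q) (x (Suc q) \<circ> \<sigma> (Suc q))) *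
      layer_factor yI yII yM col M (x M \<circ> \<sigma> M) (x (Suc M))"
      by (simp add: mult.commute)
    then show "(\<Prod>q=1..M. layer_factor yI yII yM col q (x q \<circ> \<sigma> q) (if q = M then x (Suc M) else x (Suc q) \<circ> \<sigma> (Suc q))) =
      (\<Prod>p\<in>{1..<M}.
         (\<Prod>a=1..k p.
            (\<Prod>i=1..nth_smallest (I_tilde col p) a - 1. x p (\<sigma> p a) - m yI yII p (\<lambda>a. x (p + 1) (\<sigma> (p + 1) a)) i) *
            (\<Prod>i=nth_smallest (I_tilde col p) a + 1..N p. x p (\<sigma> p a) - m yI yII p (\<lambda>a. x (p + 1) (\<sigma> (p + 1) a)) i + 1)) *
         pair_factor (k p) (\<lambda>a. x p (\<sigma> p a))) *
      (\<Prod>a=1..k M.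
         (\<Prod>i=1..nth_smallest (I_set col M) a - 1 - ell. x M (\<sigma> M a) - yM i) *
         (\<Prod>i=nth_smallest (I_set col M) a + 1 - ell..LM. x M (\<sigma> M a) - yM i + 1)) *
      pair_factor (k M) (\<lambda>a. x M (\<sigma> M a))"
      by (simp add: layer_factor_top[OF adm M] layer_factor_lower o_def mult.assoc)
  qed
  finally show ?thesis .
qed

end

text \<open>Distinct entries within each list keep the denominators of \<open>W\<close> nonzero; a
  field of characteristic 0 is infinite, so agreement at all such points is an identity of rational
  functions.\<close>

theorem theorem2p3:
  fixes M :: nat and k LI LII :: "nat \<Rightarrow> nat" and LM :: nat
    and x yI yII :: "nat \<Rightarrow> nat \<Rightarrow> 'a::field_char_0" and yM :: "nat \<Rightarrow> 'a"
    and col :: "nat \<Rightarrow> nat"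
  assumes "M \<ge> 1"
    and "layers.admissible M k LI LII LM col"
    and "\<forall>p\<in>{1..M}. inj_on (x p) {1..k p}"
  shows "layers.psi M k LI LII LM x yI yII yM col = layers.W M k LI LII LM x yI yII yM col"
  using assms by (rule layers.psi_eq_W)

end
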